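(* The rectification map $\mathrm{rect}$ from diagonal skew tableaux over $[n]$ to Young tableaux over $[n]$ is surjective and is a morphism of string data structures from $(\mathrm{dSkew}(n),I_r^a,R_{SW})$ to $(\mathrm{Young}(n),S_r,R_{SW})$; that is, $\mathrm{rect}(\emptyset)=\emptyset$, $\mathrm{rect}(d\leftarrow_{I_r^a}x)=\mathrm{rect}(d)\leftarrow_{S_r}x$ and $C_{\mathrm{Y}}(R_{SW}(d))=C_{\mathrm{Y}}(R_{SW}(\mathrm{rect}(d)))$ for all $d\in\mathrm{dSkew}(n)$, $x\in[n]$, where $C_{\mathrm{Y}}(w)=\emptyset\leftarrow_{S_r}w$. Respectively, $\mathrm{rect}$ is a (surjective) morphism of left string data structures from $(\mathrm{dSkew}(n),I_l^a,R_{SW})$ to $(\mathrm{Young}(n),S_l,R_{SW})$: $\mathrm{rect}(x\rightarrow_{I_l^a}d)=x\rightarrow_{S_l}\mathrm{rect}(d)$ and $C'_{\mathrm{Y}}(R_{SW}(d))=C'_{\mathrm{Y}}(R_{SW}(\mathrm{rect}(d)))$, where $C'_{\mathrm{Y}}(w)=w\rightarrow_{S_l}\emptyset$.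
   Context: Fix $n\geq1$, $[n]=\{1<\dots<n\}$, $[n]^\ast$ with empty word $\lambda$. For a word $u$ and a structure with insertion $I$: $d\leftarrow_Iu$ inserts the letters of $u$ one by one from left to right ($d\leftarrow_I\lambda=d$, $d\leftarrow_I xu'=I(d,x)\leftarrow_Iu'$), and $u\rightarrow_I d$ inserts the letters of $u$ one by one from right to left ($\lambda\rightarrow_Id=d$, $u'x\rightarrow_Id=u'\rightarrow_I I(d,x)$). $\emptyset$ denotes the empty tableau. Columns are strictly increasing (top to bottom) sequences in $[n]$. The south-west reading $R_{SW}$ of an arrangement of columns reads the columns from left to right, each from bottom to top. Diagonal skew tableaux: a sequence of nonempty columns $c_1,\dots,c_m$ placed in consecutive positions from left to right so that the bottom box of $c_{k+1}$ is in the same row as the top box of $c_k$, with (top entry of $c_k$) $\leq$ (bottom entry of $c_{k+1}$). $\mathrm{dSkew}(n)$ is the set of these (including $\emptyset$); $R_{SW}$ is a bijection $\mathrm{dSkew}(n)\to[n]^\ast$ (the columns correspond to the factorization of the word into maximal strictly decreasing factors). Top concatenation $I_r^a$: for $d$ with last column $c=(c^1<\dots<c^k)$ and $x\in[n]$, if $x\geq c^1$ append a new column $(x)$ to the right (bottom of the new column in the row of $c^1$), otherwise put $x$ on top of $c$, giving column $(x,c^1,\dots,c^k)$; $I_r^a(\emptyset,x)=(x)$. Bottom concatenation $I_l^a$: for first column $c$, if $x>c^k$ put $x$ at the bottom of $c$, otherwise add a new column $(x)$ to the left, whose box is in the row of the bottom box of $c$'s... more precisely the new first column $(x)$ is placed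 so that the old first column's bottom box is in the row of $x$'s box; $I_l^a(\emptyset,x)=(x)$. Young tableaux: top-aligned columns with weakly decreasing lengths from left to right, rows weakly increasing from left to right (semistandard Young tableaux in English convention); $\mathrm{Young}(n)$ is their set. $S_r$ is Schensted's row insertion: insert $x$ into the first row; if $x$ is $\geq$ all entries, append it at the end; otherwise $x$ replaces the leftmost entry $y>x$, and $y$ is inserted into the next row in the same way (creating a new row at the bottom if needed). $S_l$ is Schensted's column insertion: insert $x$ into the first column; if $x$ is strictly greater than all entries, place it at the bottom; otherwise $x$ replaces the topmost entry $y\geq x$, and $y$ is inserted into the next column in the same way (creating a new column if needed). Rectification (jeu de taquin): for a skew tableau (in particular a diagonal skew tableau, viewed as a semistandard skew tableau in English notation), repeatedly choose an inner corner (an empty cell of the skew shape's inner part that is above and to the left of filled cells) and perform Schützenberger's forward slide (move the empty cell right or down, exchanging with the smaller of its right and lower neighbours, taking the lower one in case of equality, until it becomes an outer corner), until no inner corners remain; the result $\mathrm{rect}(d)$ is a Young tableau, independent of the choices of inner corners. *)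

theory Defs
  imports Main
begin

text \<open>
  Words over \<open>[n] = {1..n}\<close> are lists of naturals.  A column is listed from top to bottom, and an
  arrangement of columns (diagonal skew tableau or Young tableau) is the list of its columns from
  left to right; the vertical placement is determined by the kind of tableau.  The empty tableau
  is \<open>[]\<close>.
\<close>

type_synonym columns = "nat list list"

definition is_column :: "nat \<Rightarrow> nat list \<Rightarrow> bool" where
  "is_column n c \<longleftrightarrow> c \<noteq> [] \<and> set c \<subseteq> {1..n} \<and> sorted_wrt (<) c"

definition R_SW :: "columns \<Rightarrow> nat list" where
  "R_SW d = concat (map rev d)"


definition insert_right :: "('d \<Rightarrow> nat \<Rightarrow> 'd) \<Rightarrow> 'd \<Rightarrow> nat list \<Rightarrow> 'd" where
  "insert_right I d u = foldl I d u"

definition insert_left :: "('d \<Rightarrow> nat \<Rightarrow> 'd) \<Rightarrow> nat list \<Rightarrow> 'd \<Rightarrow> 'd" where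
  "insert_left I u d = foldr (\<lambda>x d'. I d' x) u d"

text \<open>
  A structure is given by its carrier, empty element, one-letter insertion and reading map.
\<close>

definition right_morphism ::
  "nat \<Rightarrow> 'd set \<Rightarrow> 'd \<Rightarrow> ('d \<Rightarrow> nat \<Rightarrow> 'd) \<Rightarrow> ('d \<Rightarrow> nat list)
       \<Rightarrow> 'e set \<Rightarrow> 'e \<Rightarrow> ('e \<Rightarrow> nat \<Rightarrow> 'e) \<Rightarrow> ('e \<Rightarrow> nat list) \<Rightarrow> ('d \<Rightarrow> 'e) \<Rightarrow> bool" where
  "right_morphism n D e I R D' e' I' R' f \<longleftrightarrow>
     f ` D \<subseteq> D' \<and> f e = e' \<and>
     (\<forall>d\<in>D. \<forall>x\<in>{1..n}. f (insert_right I d [x]) = insert_right I' (f d) [x]) \<and>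
     (\<forall>d\<in>D. insert_right I' e' (R d) = insert_right I' e' (R' (f d)))"

definition left_morphism ::
  "nat \<Rightarrow> 'd set \<Rightarrow> 'd \<Rightarrow> ('d \<Rightarrow> nat \<Rightarrow> 'd) \<Rightarrow> ('d \<Rightarrow> nat list)
       \<Rightarrow> 'e set \<Rightarrow> 'e \<Rightarrow> ('e \<Rightarrow> nat \<Rightarrow> 'e) \<Rightarrow> ('e \<Rightarrow> nat list) \<Rightarrow> ('d \<Rightarrow> 'e) \<Rightarrow> bool" where
  "left_morphism n D e I R D' e' I' R' f \<longleftrightarrow>
     f ` D \<subseteq> D' \<and> f e = e' \<and>
     (\<forall>d\<in>D. \<forall>x\<in>{1..n}. f (insert_left I [x] d) = insert_left I' [x] (f d)) \<and>
     (\<forall>d\<in>D. insert_left I' (R d) e' = insert_left I' (R' (f d)) e')"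


definition dSkew :: "nat \<Rightarrow> columns set" where
  "dSkew n = {d. (\<forall>c\<in>set d. is_column n c) \<and>
                 (\<forall>k. Suc k < length d \<longrightarrow> hd (d ! k) \<le> last (d ! Suc k))}"

definition I_r_a :: "columns \<Rightarrow> nat \<Rightarrow> columns" where
  "I_r_a d x =
     (if d = [] then [[x]]
      else if hd (last d) \<le> x then d @ [[x]]
      else butlast d @ [x # last d])"

fun I_l_a :: "columns \<Rightarrow> nat \<Rightarrow> columns" where
  "I_l_a [] x = [[x]]"
| "I_l_a (c # d) x = (if last c < x then (c @ [x]) # d else [x] # c # d)"


definition Young :: "nat \<Rightarrow> columns set" where
  "Young n = {t. (\<forall>c\<in>set t. is_column n c) \<and>
                 (\<forall>k. Suc k < length t \<longrightarrow>
                      length (t ! Suc k) \<le> length (t ! k) \<and>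
                      (\<forall>i < length (t ! Suc k). t ! k ! i \<le> t ! Suc k ! i))}"

text \<open>
  \<open>bump r x l\<close> replaces the first entry \<open>y\<close> of the line \<open>l\<close> with \<open>r x y\<close> by \<open>x\<close> and returns the
  replaced entry; if there is none, \<open>x\<close> is appended.
\<close>

fun bump :: "(nat \<Rightarrow> nat \<Rightarrow> bool) \<Rightarrow> nat \<Rightarrow> nat list \<Rightarrow> nat list \<times> nat option" where
  "bump r x [] = ([x], None)"
| "bump r x (y # ys) =
     (if r x y then (x # ys, Some y)
      else (case bump r x ys of (zs, b) \<Rightarrow> (y # zs, b)))"

fun schensted :: "(nat \<Rightarrow> nat \<Rightarrow> bool) \<Rightarrow> nat list list \<Rightarrow> nat \<Rightarrow> nat list list" where
  "schensted r [] x = [[x]]"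
| "schensted r (l # ls) x =
     (case bump r x l of
        (l', None) \<Rightarrow> l' # ls
      | (l', Some y) \<Rightarrow> l' # schensted r ls y)"

text \<open>
  On top-aligned columns of weakly decreasing lengths, \<^const>\<open>transpose\<close> yields the list of rows,
  and it turns such a list of rows back into the list of columns.
\<close>

definition S_r :: "columns \<Rightarrow> nat \<Rightarrow> columns" where
  "S_r t x = transpose (schensted (<) (transpose t) x)"

definition S_l :: "columns \<Rightarrow> nat \<Rightarrow> columns" where
  "S_l t x = schensted (\<le>) t x"


text \<open>
  Cells are pairs (row, column), counted from \<open>0\<close>, rows downwards and columns to the right.  A skew
  tableau of shape \<open>\<lambda>/\<mu>\<close> is the pair of the cell set of \<open>\<mu>\<close> and the filling, whose domain is \<open>\<lambda>/\<mu>\<close>.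
\<close>

type_synonym cell = "nat \<times> nat"
type_synonym filling = "cell \<Rightarrow> nat option"

fun lower :: "cell \<Rightarrow> cell" where "lower (i, j) = (Suc i, j)"
fun right :: "cell \<Rightarrow> cell" where "right (i, j) = (i, Suc j)"

text \<open>The columns \<open>d\<close> in consecutive positions, the top box of column \<open>j\<close> being in row \<open>s j\<close>.\<close>

definition place :: "(nat \<Rightarrow> nat) \<Rightarrow> columns \<Rightarrow> filling" where
  "place s d = (\<lambda>(i, j). if j < length d \<and> s j \<le> i \<and> i < s j + length (d ! j)
                         then Some (d ! j ! (i - s j)) else None)"

text \<open>
  The bottom box of column \<open>k + 1\<close> lies in the row of the top box of column \<open>k\<close>, so the top of
  column \<open>k\<close> is \<open>length (d ! (k + 1)) - 1\<close> rows below that of column \<open>k + 1\<close>; the last column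
  starts in row \<open>0\<close>.
\<close>

definition diag_top :: "columns \<Rightarrow> nat \<Rightarrow> nat" where
  "diag_top d k = (\<Sum>j\<in>{k<..<length d}. length (d ! j) - 1)"

definition diag_skew :: "columns \<Rightarrow> cell set \<times> filling" where
  "diag_skew d = ({(i, j). j < length d \<and> i < diag_top d j}, place (diag_top d) d)"

text \<open>
  \<open>forward_slide T h T'\<close>: starting from the empty cell \<open>h\<close>, the forward slide turns \<open>T\<close> into \<open>T'\<close>.
\<close>

inductive forward_slide :: "filling \<Rightarrow> cell \<Rightarrow> filling \<Rightarrow> bool" where
  stop: "\<lbrakk>T (lower h) = None; T (right h) = None\<rbrakk> \<Longrightarrow> forward_slide T h T"
| down: "\<lbrakk>T (lower h) = Some y; \<forall>x. T (right h) = Some x \<longrightarrow> y \<le> x;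
          forward_slide (T(h := Some y, lower h := None)) (lower h) T'\<rbrakk>
         \<Longrightarrow> forward_slide T h T'"
| across: "\<lbrakk>T (right h) = Some x; \<forall>y. T (lower h) = Some y \<longrightarrow> x < y;
            forward_slide (T(h := Some x, right h := None)) (right h) T'\<rbrakk>
           \<Longrightarrow> forward_slide T h T'"

definition inner_corner :: "cell set \<Rightarrow> cell \<Rightarrow> bool" where
  "inner_corner \<mu> h \<longleftrightarrow> h \<in> \<mu> \<and> lower h \<notin> \<mu> \<and> right h \<notin> \<mu>"

inductive jdt :: "cell set \<times> filling \<Rightarrow> cell set \<times> filling \<Rightarrow> bool" where
  "\<lbrakk>inner_corner \<mu> h; forward_slide T h T'\<rbrakk> \<Longrightarrow> jdt (\<mu>, T) (\<mu> - {h}, T')"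

text \<open>
  The definite description ranges over the outcomes of all sequences of choices of inner corners.
  The condition \<open>[] \<notin> set t\<close> makes the list of columns determined by the final filling.
\<close>

definition rect :: "columns \<Rightarrow> columns" where
  "rect d = (THE t. [] \<notin> set t \<and>
       (\<exists>\<mu>. jdt\<^sup>*\<^sup>* (diag_skew d) (\<mu>, place (\<lambda>_. 0) t) \<and> (\<nexists>h. inner_corner \<mu> h)))"

end

theory Submission
  imports Defs
begin

text \<open>
  A forward slide moves a letter from one column to the preceding one, and this does not change the
  plactic class of the south-west reading.  Two Young tableaux with plactically equivalent readings
  are equal, because column insertion is invariant under the Knuth relations and inserting the
  reading of a Young tableau into the empty tableau returns it.  So \<open>rect d\<close> is the only Young
  tableau whose reading is equivalent to that of \<open>d\<close>.  The insertions into \<open>d\<close> append a letter to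
  its reading, those into \<open>rect d\<close> do so up to equivalence, and this yields the morphism properties.
\<close>

subsection \<open>Plactic congruence\<close>

text \<open>A filling without inner corners is given only as the outcome of some sequence of slides,
  so the definite description in \<open>rect\<close> calls for an invariant shared by all choices of
  corners. Only horizontal moves change the reading, and they involve two columns whose tops and
  bottoms need not match; this is why the two columns are cut at the row of the hole and treated
  separately above and below it. Column insertion is reduced to a single column, seen as a device
  that turns a word into the word of letters it expels: equivalent words leave the same column and
  expel equivalent words. Row insertion is followed only through its effect on readings, with the
  row reading as intermediary, and its results are then identified by the uniqueness of the Young
  tableau in a class.\<close>

inductive knuth :: "nat list \<Rightarrow> nat list \<Rightarrow> bool" where
  knuth_left: "\<lbrakk>x \<le> y; y < z\<rbrakk> \<Longrightarrow> knuth (u @ [x, z, y] @ v) (u @ [z, x, y] @ v)"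
| knuth_right: "\<lbrakk>x < y; y \<le> z\<rbrakk> \<Longrightarrow> knuth (u @ [y, z, x] @ v) (u @ [y, x, z] @ v)"

definition plactic :: "nat list \<Rightarrow> nat list \<Rightarrow> bool" (infix "\<sim>" 50) where
  "plactic = equivclp knuth"

lemma plactic_refl [simp, intro!]: "u \<sim> u"
  by (simp add: plactic_def)

lemma plactic_sym: "u \<sim> v \<Longrightarrow> v \<sim> u"
  by (simp add: plactic_def equivclp_sym)

lemma plactic_trans [trans]: "u \<sim> v \<Longrightarrow> v \<sim> w \<Longrightarrow> u \<sim> w"
  unfolding plactic_def by (rule equivclp_trans)

lemma knuth_context: "knuth u v \<Longrightarrow> knuth (a @ u @ b) (a @ v @ b)"
proof (induction rule: knuth.induct)
  case (knuth_left x y z u v)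
  then show ?case using knuth.knuth_left[of x y z "a @ u" "v @ b"] by simp
next
  case (knuth_right x y z u v)
  then show ?case using knuth.knuth_right[of x y z "a @ u" "v @ b"] by simp
qed

lemma plactic_induct [consumes 1, case_names refl knuth sym trans]:
  assumes "u \<sim> v" "\<And>u. P u u" "\<And>u v. knuth u v \<Longrightarrow> P u v"
    "\<And>u v. P u v \<Longrightarrow> P v u" "\<And>u v w. P u v \<Longrightarrow> P v w \<Longrightarrow> P u w"
  shows "P u v"
  using assms(1) unfolding plactic_def
  by (induction rule: equivclp_induct) (use assms(2-) in blast)+

lemma knuth_imp_plactic: "knuth u v \<Longrightarrow> u \<sim> v"
  unfolding plactic_def by (rule r_into_equivclp)

lemma plactic_context: "u \<sim> v \<Longrightarrow> a @ u @ b \<sim> a @ v @ b"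
  by (induction rule: plactic_induct)
    (auto intro: knuth_imp_plactic knuth_context plactic_sym plactic_trans)

lemma plactic_append_left: "u \<sim> v \<Longrightarrow> a @ u \<sim> a @ v"
  using plactic_context[of u v a "[]"] by simp

lemma plactic_append_right: "u \<sim> v \<Longrightarrow> u @ b \<sim> v @ b"
  using plactic_context[of u v "[]" b] by simp

lemma plactic_Cons: "u \<sim> v \<Longrightarrow> x # u \<sim> x # v"
  using plactic_append_left[of u v "[x]"] by simp

lemma plactic_xzy: "x \<le> y \<Longrightarrow> y < z \<Longrightarrow> x # z # y # v \<sim> z # x # y # v"
  using knuth_imp_plactic[OF knuth_left[of x y z "[]" v]] by simp

lemma plactic_yzx: "x < y \<Longrightarrow> y \<le> z \<Longrightarrow> y # z # x # v \<sim> y # x # z # v"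
  using knuth_imp_plactic[OF knuth_right[of x y z "[]" v]] by simp

text \<open>In a Knuth relation \<open>z\<close> is a largest letter, so a cutoff that removes any
  letter removes \<open>z\<close>, and without \<open>z\<close> both sides coincide. This serves to
  discard padding letters.\<close>

lemma plactic_filter: "u \<sim> v \<Longrightarrow> filter (\<lambda>x. x < N) u \<sim> filter (\<lambda>x. x < N) v"
proof (induction rule: plactic_induct)
  case (knuth u v)
  then show ?case
  proof cases
    case (knuth_left x y z a b)
    have "filter (\<lambda>x. x < N) [x, z, y] \<sim> filter (\<lambda>x. x < N) [z, x, y]"
      using knuth_left plactic_xzy[of x y z "[]"] by auto
    from plactic_context[OF this, of "filter (\<lambda>x. x < N) a" "filter (\<lambda>x. x < N) b"]
    show ?thesis unfolding knuth_left filter_append .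
  next
    case (knuth_right x y z a b)
    have "filter (\<lambda>x. x < N) [y, z, x] \<sim> filter (\<lambda>x. x < N) [y, x, z]"
      using knuth_right plactic_yzx[of x y z "[]"] by auto
    from plactic_context[OF this, of "filter (\<lambda>x. x < N) a" "filter (\<lambda>x. x < N) b"]
    show ?thesis unfolding knuth_right filter_append .
  qed
qed (auto intro: plactic_sym plactic_trans)

section \<open>Moving letters past columns and rows\<close>

text \<open>The letter \<open>x\<close> jumps over the entries of \<open>c\<close> from the bottom
  up, each time with the entry just above as the middle letter of a Knuth relation. The top entry
  \<open>y\<close> serves the last jump and stays at the right end.\<close>

lemma plactic_past_column_left:
  assumes "sorted_wrt (<) (y # c)" "x \<le> y"
  shows "x # rev c @ [y] \<sim> rev c @ [x, y]"
  using assms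
proof (induction c rule: rev_induct)
  case (snoc z c)
  show ?case
  proof (cases c rule: rev_cases)
    case Nil
    with snoc.prems show ?thesis by (auto intro: plactic_xzy)
  next
    case (snoc c' w)
    have "x # rev (c @ [z]) @ [y] \<sim> z # x # rev c @ [y]"
      using snoc snoc.prems plactic_xzy[of x w z] by (auto simp: sorted_wrt_append)
    also have "\<dots> \<sim> z # rev c @ [x, y]"
      using snoc.IH snoc.prems by (intro plactic_Cons) (auto simp: sorted_wrt_append)
    finally show ?thesis by simp
  qed
qed simp

text \<open>Now \<open>x\<close> comes from the right; a jump over an entry uses the next larger
  entry of the column, standing just left of it, and \<open>y\<close> is the last one used.\<close>

lemma plactic_past_column_right:
  assumes "sorted_wrt (<) (c @ [y])" "y \<le> x"
  shows "y # rev c @ [x] \<sim> y # x # rev c"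
  using assms
proof (induction c arbitrary: y rule: rev_induct)
  case (snoc z c)
  have "y # rev (c @ [z]) @ [x] \<sim> y # z # x # rev c"
    using snoc.IH[of z] snoc.prems by (auto simp: sorted_wrt_append intro: plactic_Cons)
  also have "\<dots> \<sim> y # x # z # rev c"
    using plactic_sym[OF plactic_yzx[of z y x]] snoc.prems by (auto simp: sorted_wrt_append)
  finally show ?case by simp
qed simp

text \<open>With \<open>plactic_past_row_right\<close> this makes up one row bump: in a row
  \<open>a y b\<close> followed by \<open>x\<close>, the letter \<open>x\<close> travels left to
  \<open>y\<close>, and then \<open>y\<close> leaves to the left of \<open>a\<close>.\<close>

lemma plactic_past_row_left:
  assumes "sorted r" "\<forall>a\<in>set r. a \<le> x" "x < y"
  shows "r @ [y, x] \<sim> y # r @ [x]"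
  using assms
proof (induction r arbitrary: x rule: rev_induct)
  case (snoc a r)
  have "(r @ [a]) @ [y, x] \<sim> r @ [y, a, x]"
    using snoc.prems plactic_append_left[OF plactic_xzy[of a x y]] by simp
  also have "\<dots> \<sim> y # r @ [a, x]"
    using plactic_append_right[OF snoc.IH[of a], of "[x]"] snoc.prems
    by (auto simp: sorted_append)
  finally show ?case by simp
qed simp

lemma plactic_past_row_right:
  assumes "sorted (y # r)" "x < y"
  shows "y # r @ [x] \<sim> y # x # r"
  using assms
proof (induction r arbitrary: y)
  case (Cons z r)
  have "y # (z # r) @ [x] \<sim> y # z # x # r"
    using Cons by (auto intro: plactic_Cons)
  also have "\<dots> \<sim> y # x # z # r"
    using Cons.prems by (auto intro: plactic_yzx)
  finally show ?case .
qed simp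

text \<open>The row letters cross the column from the last one on, each with its right neighbour as
  witness. Each is at most \<open>b\<close>, hence smaller than all of \<open>c\<close>, and can be
  the next witness.\<close>

lemma plactic_row_past_column:
  assumes "sorted (r @ [b])" "sorted_wrt (<) (b # c)"
  shows "r @ rev c @ [b] \<sim> rev c @ r @ [b]"
  using assms
proof (induction r arbitrary: b rule: rev_induct)
  case (snoc a r)
  have "(r @ [a]) @ rev c @ [b] \<sim> r @ rev c @ [a, b]"
    using plactic_append_left[OF plactic_past_column_left[of b c a]] snoc.prems
    by (auto simp: sorted_append)
  also have "\<dots> \<sim> rev c @ (r @ [a]) @ [b]"
    using plactic_append_right[OF snoc.IH[of a], of "[b]"] snoc.prems
    by (fastforce simp: sorted_append)
  finally show ?case .
qed simp

section \<open>The two halves of a horizontal move\<close>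

text \<open>For the bottom pair, \<open>q \<le> s < x\<close> makes the exchange of \<open>q\<close>
  and \<open>x\<close> a Knuth relation as soon as \<open>s\<close> stands next to them. The
  induction hypothesis brings \<open>s\<close> there and afterwards returns it.\<close>

lemma plactic_slide_upper:
  assumes "list_all2 (\<le>) Q S" "sorted_wrt (<) Q" "sorted_wrt (<) (S @ [x])"
  shows "rev Q @ x # rev S \<sim> x # rev Q @ rev S"
  using assms
proof (induction Q arbitrary: S x rule: rev_induct)
  case (snoc q Q)
  then obtain S' s where S: "S = S' @ [s]" "list_all2 (\<le>) Q S'" "q \<le> s"
    by (auto simp: list_all2_append1 list_all2_Cons1)
  have IH: "rev Q @ s # rev S' \<sim> s # rev Q @ rev S'"
    using snoc.prems S by (intro snoc.IH) (auto simp: sorted_wrt_append)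
  have "rev (Q @ [q]) @ x # rev S \<sim> q # x # rev Q @ s # rev S'"
    using plactic_append_right[OF plactic_past_column_right[of Q q x], of "s # rev S'"]
      snoc.prems S by (auto simp: sorted_wrt_append)
  also have "\<dots> \<sim> q # x # s # rev Q @ rev S'"
    using IH by (intro plactic_Cons)
  also have "\<dots> \<sim> x # q # s # rev Q @ rev S'"
    using snoc.prems S by (intro plactic_xzy) (auto simp: sorted_wrt_append)
  also have "\<dots> \<sim> x # q # rev Q @ s # rev S'"
    using IH by (intro plactic_Cons plactic_sym[OF IH])
  finally show ?case by (simp add: S)
qed simp

text \<open>The letter \<open>x\<close> crosses all of \<open>R\<close> but its top
  \<open>r\<close>. For the exchange of \<open>x\<close> and \<open>r\<close> a witness
  \<open>p\<close> with \<open>x < p \<le> r\<close> is needed: the top of \<open>P\<close>, carried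
  across by the induction hypothesis with \<open>p\<close> in the role of \<open>x\<close>, and then
  returned.\<close>

lemma plactic_slide_lower:
  assumes "length R \<le> length P" "\<forall>k<length R. P ! k \<le> R ! k"
    "sorted_wrt (<) (x # P)" "sorted_wrt (<) R"
  shows "rev P @ x # rev R \<sim> rev P @ rev R @ [x]"
  using assms
proof (induction R arbitrary: P x)
  case (Cons r R)
  then obtain p P' where P: "P = p # P'" by (cases P) auto
  have pr: "p \<le> r" "length R \<le> length P'" "\<forall>k<length R. P' ! k \<le> R ! k"
    using Cons.prems P by auto
  have IH: "rev P' @ p # rev R \<sim> rev P' @ rev R @ [p]"
    using Cons.prems P pr by (intro Cons.IH) auto
  have "rev P @ x # rev (r # R) \<sim> rev P @ rev R @ [x, r]"
    using plactic_append_left[OF plactic_past_column_left[of r R x], of "rev P"]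
      Cons.prems P pr by auto
  also have "\<dots> \<sim> rev P' @ rev R @ [p, x, r]"
    using plactic_append_right[OF IH, of "[x, r]"] P by simp
  also have "\<dots> \<sim> rev P' @ rev R @ [p, r, x]"
    using Cons.prems P pr
    by (intro plactic_append_left plactic_sym[OF plactic_yzx]) auto
  also have "\<dots> \<sim> rev P @ rev (r # R) @ [x]"
    using plactic_append_right[OF plactic_sym[OF IH], of "[r, x]"] P by simp
  finally show ?case .
qed simp

text \<open>The entries of \<open>Q\<close> cross \<open>R\<close> one at a time from the top down,
  the lower ones counting as part of the left column. Extending \<open>P\<close> upwards only lowers
  its entry at a given index, so it stays dominated by \<open>R\<close>.\<close>

lemma plactic_slide_lower_column:
  assumes "length R \<le> length P" "\<forall>k<length R. P ! k \<le> R ! k"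
    "sorted_wrt (<) (Q @ P)" "sorted_wrt (<) R"
  shows "rev P @ rev Q @ rev R \<sim> rev P @ rev R @ rev Q"
  using assms
proof (induction Q)
  case (Cons q Q)
  have le: "(Q @ P) ! k \<le> P ! k" if "k < length P" for k
  proof (cases "Q = []")
    case False
    have "(Q @ P) ! k < (Q @ P) ! (length Q + k)"
      using that False Cons.prems(3) by (intro sorted_wrt_nth_less[of "(<)"]) auto
    then show ?thesis by (simp add: nth_append)
  qed simp
  have "rev (Q @ P) @ q # rev R \<sim> rev (Q @ P) @ rev R @ [q]"
    using Cons.prems le
    by (intro plactic_slide_lower) (auto intro: order_trans[OF le])
  then have "rev P @ rev (q # Q) @ rev R \<sim> (rev P @ rev Q @ rev R) @ [q]" by simp
  also have "\<dots> \<sim> (rev P @ rev R @ rev Q) @ [q]"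
    using Cons by (intro plactic_append_right) auto
  finally show ?case by simp
qed simp

text \<open>
  The lower part \<open>R\<close> of the right column is first taken out of the way of \<open>x\<close>, which is possible
  next to the lower part \<open>P\<close> of the left column, and is put back once \<open>x\<close> has joined the left column.
\<close>

lemma plactic_slide:
  assumes "length R \<le> length P" "\<forall>k<length R. P ! k \<le> R ! k"
    "sorted_wrt (<) (Q @ x # P)" "sorted_wrt (<) (S @ x # R)" "list_all2 (\<le>) Q S"
  shows "rev P @ rev Q @ rev R @ x # rev S \<sim> rev P @ x # rev Q @ rev R @ rev S"
proof -
  have "rev P @ rev Q @ rev R @ x # rev S \<sim> rev P @ rev R @ rev Q @ x # rev S"
    using plactic_append_right[OF plactic_slide_lower_column[of R P Q], of "x # rev S"] assms
    by (auto simp: sorted_wrt_append)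
  also have "\<dots> \<sim> rev P @ rev R @ x # rev Q @ rev S"
    using assms by (intro plactic_append_left plactic_slide_upper) (auto simp: sorted_wrt_append)
  also have "\<dots> \<sim> rev P @ x # rev R @ rev Q @ rev S"
    using plactic_append_right[OF plactic_sym[OF plactic_slide_lower[of R P x]], of "rev Q @ rev S"]
      assms by (auto simp: sorted_wrt_append)
  also have "\<dots> \<sim> rev P @ x # rev Q @ rev R @ rev S"
  proof -
    \<comment> \<open>Putting \<open>x\<close> on top shifts the left column by one index; the
      strict increase of \<open>R\<close> absorbs the shift.\<close>
    have "(x # P) ! k \<le> R ! k" if "k < length R" for k
    proof (cases k)
      case 0
      then show ?thesis using assms(4) that by (cases R) (auto simp: sorted_wrt_append)
    next
      case (Suc m)
      then have "P ! m \<le> R ! m" "R ! m < R ! k"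
        using assms that by (auto simp: sorted_wrt_append intro: sorted_wrt_nth_less[of "(<)"])
      then show ?thesis using Suc by simp
    qed
    then have "rev (x # P) @ rev Q @ rev R \<sim> rev (x # P) @ rev R @ rev Q"
      using assms by (intro plactic_slide_lower_column) (auto simp: sorted_wrt_append)
    from plactic_append_right[OF plactic_sym[OF this], of "rev S"] show ?thesis by simp
  qed
  finally show ?thesis .
qed

subsection \<open>Column insertion\<close>

lemma bump_NoneD: "bump r x l = (l', None) \<Longrightarrow> l' = l @ [x] \<and> (\<forall>z\<in>set l. \<not> r x z)"
  by (induction l arbitrary: l') (auto split: if_splits prod.splits)

lemma bump_SomeD:
  "bump r x l = (l', Some y) \<Longrightarrow>
     \<exists>a b. l = a @ y # b \<and> l' = a @ x # b \<and> r x y \<and> (\<forall>z\<in>set a. \<not> r x z)"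
proof (induction l arbitrary: l')
  case (Cons z l)
  show ?case
  proof (cases "r x z")
    case True
    then show ?thesis using Cons.prems by (auto intro: exI[of _ "[]"])
  next
    case False
    then obtain l'' where l'': "bump r x l = (l'', Some y)" "l' = z # l''"
      using Cons.prems by (auto split: prod.splits)
    then obtain a b where "l = a @ y # b" "l'' = a @ x # b" "r x y" "\<forall>z\<in>set a. \<not> r x z"
      using Cons.IH by blast
    then show ?thesis using l'' False by (intro exI[of _ "z # a"] exI[of _ b]) auto
  qed
qed simp

lemma bump_append:
  "\<forall>z\<in>set a. \<not> r x z \<Longrightarrow> bump r x (a @ b) = (a @ fst (bump r x b), snd (bump r x b))"
  by (induction a) (auto simp: case_prod_beta)

text \<open>A column as a transducer: \<open>w\<close> enters from right to left, and the second
  component is the word of expelled letters, already in the order in which it enters the next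
  column.\<close>

fun cross :: "nat list \<Rightarrow> nat list \<Rightarrow> nat list \<times> nat list" where
  "cross c [] = (c, [])"
| "cross c (x # w) =
     (case cross c w of (c', w') \<Rightarrow>
        (case bump (\<le>) x c' of
           (c'', None) \<Rightarrow> (c'', w')
         | (c'', Some y) \<Rightarrow> (c'', y # w')))"

lemma insert_left_S_l_Cons:
  "insert_left S_l w (c # t) = fst (cross c w) # insert_left S_l (snd (cross c w)) t"
  by (induction w) (auto simp: insert_left_def S_l_def split: prod.splits option.splits)

text \<open>Treats the empty tableau as one empty column, so that
  \<open>insert_left_S_l_Cons\<close> also covers the creation of a column.\<close>

lemma insert_left_S_l_empty:
  "w \<noteq> [] \<Longrightarrow> insert_left S_l w [] = insert_left S_l w [[]]"
proof (induction w rule: rev_induct)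
  case (snoc x w)
  then show ?case by (simp add: insert_left_def S_l_def)
qed simp

text \<open>The first letter to arrive is kept without expelling anything. This drives the induction
  over the columns.\<close>

lemma length_cross_Nil: "w \<noteq> [] \<Longrightarrow> length (snd (cross [] w)) < length w"
proof (induction w)
  case (Cons x w)
  then show ?case
    by (cases w) (auto split: prod.splits option.splits)
qed simp

text \<open>
  To avoid distinguishing whether a letter is appended or replaces another one, a column is padded
  with infinitely many letters that are too large to occur in the words considered.
\<close>

definition least_ge :: "nat set \<Rightarrow> nat \<Rightarrow> nat" where
  "least_ge C x = (LEAST y. y \<in> C \<and> x \<le> y)"

definition put :: "nat set \<Rightarrow> nat \<Rightarrow> nat set" where
  "put C x = insert x (C - {least_ge C x})"

fun padded_cross :: "nat set \<Rightarrow> nat list \<Rightarrow> nat set \<times> nat list" where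
  "padded_cross C [] = (C, [])"
| "padded_cross C (x # w) =
     (case padded_cross C w of (C', w') \<Rightarrow> (put C' x, least_ge C' x # w'))"

lemma least_ge:
  assumes "infinite C"
  shows "least_ge C x \<in> C" "x \<le> least_ge C x"
proof -
  have "\<exists>y. y \<in> C \<and> x \<le> y"
    using assms by (meson finite_nat_set_iff_bounded not_le)
  then have "least_ge C x \<in> C \<and> x \<le> least_ge C x"
    unfolding least_ge_def by (rule LeastI_ex)
  then show "least_ge C x \<in> C" "x \<le> least_ge C x" by auto
qed

lemma least_ge_le: "y \<in> C \<Longrightarrow> x \<le> y \<Longrightarrow> least_ge C x \<le> y"
  unfolding least_ge_def by (intro Least_le) simp

lemma least_ge_eqI:
  "y \<in> C \<Longrightarrow> x \<le> y \<Longrightarrow> (\<And>z. z \<in> C \<Longrightarrow> x \<le> z \<Longrightarrow> y \<le> z) \<Longrightarrow> least_ge C x = y"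
  unfolding least_ge_def by (intro Least_equality) auto

lemma infinite_put: "infinite C \<Longrightarrow> infinite (put C x)"
  by (simp add: put_def)

lemma infinite_padded_cross: "infinite C \<Longrightarrow> infinite (fst (padded_cross C w))"
  by (induction w) (auto simp: case_prod_beta infinite_put)

lemma padded_cross_append:
  "padded_cross C (u @ v) =
     (case padded_cross C v of (C', v') \<Rightarrow>
        (case padded_cross C' u of (C'', u') \<Rightarrow> (C'', u' @ v')))"
  by (induction u) (auto simp: case_prod_beta)

text \<open>The column bumping lemma: what \<open>z\<close> meets is neither the new
  \<open>x\<close> nor the removed \<open>least_ge C x\<close>, so it is an older entry beyond the
  latter.\<close>

lemma least_ge_put_greater:
  assumes "infinite C" "x < z" shows "least_ge C x < least_ge (put C x) z"
proof (rule ccontr)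
  let ?y = "least_ge (put C x) z"
  assume "\<not> least_ge C x < ?y"
  have y: "?y \<in> put C x" "z \<le> ?y"
    using least_ge[OF infinite_put[OF assms(1)]] by auto
  with assms(2) have "?y \<in> C" "?y \<noteq> least_ge C x"
    unfolding put_def by auto
  with least_ge_le[of ?y C x] y assms(2) \<open>\<not> least_ge C x < ?y\<close> show False by linarith
qed

lemma least_ge_put_le:
  assumes "z \<le> x" shows "least_ge (put C x) z \<le> x"
  using assms by (intro least_ge_le) (auto simp: put_def)

section \<open>Knuth relations passing through a column\<close>

text \<open>The letter \<open>y\<close> enters before the other two and separates them:
  \<open>x\<close> expels something at most \<open>y\<close>, and \<open>z\<close> something above
  \<open>y\<close>, so these two insertions commute. The expelled letters satisfy
  \<open>x' \<le> y' < z'\<close> and form a relation of the same kind.\<close>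

lemma padded_cross_xzy:
  assumes "infinite C" "x \<le> y" "y < z"
  shows "fst (padded_cross C [x, z, y]) = fst (padded_cross C [z, x, y])"
    and "snd (padded_cross C [x, z, y]) \<sim> snd (padded_cross C [z, x, y])"
proof -
  define y' where "y' = least_ge C y"
  define C1 where "C1 = put C y"
  define z' where "z' = least_ge C1 z"
  define x' where "x' = least_ge C1 x"
  have C1: "infinite C1" "y \<in> C1" using assms by (auto simp: C1_def infinite_put) (simp add: put_def)
  have x': "x' \<in> C1" "x \<le> x'" "x' \<le> y"
    using least_ge[OF C1(1)] assms least_ge_put_le[of x y C] by (auto simp: x'_def C1_def)
  have z': "z' \<in> C1" "z \<le> z'" "y' < z'"
    using least_ge[OF C1(1)] least_ge_put_greater[OF assms(1,3)] by (auto simp: z'_def C1_def y'_def)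
  have "y \<le> y'" using least_ge[OF assms(1)] by (simp add: y'_def)
  have x'2: "least_ge (put C1 z) x = x'"
    using x' z' assms least_ge_le[of _ C1 x]
    by (intro least_ge_eqI) (auto simp: put_def simp flip: z'_def x'_def)
  have z'2: "least_ge (put C1 x) z = z'"
    using x' z' assms least_ge_le[of _ C1 z]
    by (intro least_ge_eqI) (auto simp: put_def simp flip: z'_def x'_def)
  have "put (put C1 z) x = put (put C1 x) z"
    unfolding put_def[of "put C1 z"] put_def[of "put C1 x"] x'2 z'2
    using x' z' assms by (auto simp: put_def simp flip: z'_def x'_def)
  then show "fst (padded_cross C [x, z, y]) = fst (padded_cross C [z, x, y])"
    by (simp add: C1_def)
  show "snd (padded_cross C [x, z, y]) \<sim> snd (padded_cross C [z, x, y])"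
    using plactic_xzy[of x' y' z' "[]"] x' z' \<open>y \<le> y'\<close>
    by (simp flip: C1_def y'_def z'_def x'_def add: x'2 z'2)
qed

text \<open>Here \<open>x\<close> and \<open>z\<close> enter first, in either order. If
  \<open>z \<le> p\<close>, both aim at the same entry \<open>p\<close>, and the expelled words are
  \<open>z q p\<close> and \<open>q z p\<close>, a relation of the other kind. If
  \<open>p < z\<close>, the two insertions commute, and the letter expelled by \<open>y\<close> lies
  strictly above \<open>p\<close> and weakly below \<open>q\<close>, which gives a relation of the
  same kind.\<close>

lemma padded_cross_yzx:
  assumes "infinite C" "x < y" "y \<le> z"
  shows "fst (padded_cross C [y, z, x]) = fst (padded_cross C [y, x, z])"
    and "snd (padded_cross C [y, z, x]) \<sim> snd (padded_cross C [y, x, z])"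
proof -
  define p where "p = least_ge C x"
  have p: "p \<in> C" "x \<le> p" "\<And>w. w \<in> C \<Longrightarrow> x \<le> w \<Longrightarrow> p \<le> w"
    using least_ge[OF assms(1)] least_ge_le by (auto simp: p_def)
  define q where "q = least_ge (put C x) z"
  have "q \<in> put C x" "z \<le> q" "\<And>w. w \<in> put C x \<Longrightarrow> z \<le> w \<Longrightarrow> q \<le> w"
    using least_ge[OF infinite_put[OF assms(1)]] least_ge_le by (auto simp: q_def)
  moreover have pq: "p < q"
    using least_ge_put_greater[OF assms(1), of x z] assms by (simp add: p_def q_def)
  ultimately have q: "q \<in> C" "z \<le> q" "\<And>w. w \<in> C \<Longrightarrow> w \<noteq> p \<Longrightarrow> z \<le> w \<Longrightarrow> q \<le> w"
    using assms by (auto simp: put_def simp flip: p_def)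
  have *: "fst (padded_cross C [y, z, x]) = fst (padded_cross C [y, x, z]) \<and>
    snd (padded_cross C [y, z, x]) \<sim> snd (padded_cross C [y, x, z])"
  proof (cases "z \<le> p")
    case True
    have [simp]: "least_ge C z = p"
      using p True assms by (intro least_ge_eqI) auto
    have [simp]: "least_ge (put C z) x = z"
      using p True assms by (intro least_ge_eqI) (auto simp: put_def dest: p(3))
    have eq: "put (put C z) x = insert x (insert z (C - {p}) - {z})"
      by (simp add: put_def[of "put C z"]) (simp add: put_def)
    \<comment> \<open>Old entries that are at least \<open>x\<close> are at least \<open>p\<close>,
      so the freshly inserted \<open>z\<close> is the first entry that \<open>y\<close>
      meets.\<close>
    have y1: "least_ge (put (put C x) z) y = z"
    proof (rule least_ge_eqI)
      fix w assume w: "w \<in> put (put C x) z" "y \<le> w"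
      show "z \<le> w"
      proof (rule ccontr)
        assume "\<not> z \<le> w"
        with w assms have "w \<in> C" "x \<le> w" by (auto simp: put_def)
        from p(3)[OF this] True \<open>\<not> z \<le> w\<close> show False by simp
      qed
    qed (use assms in \<open>auto simp: put_def\<close>)
    \<comment> \<open>In this order \<open>x\<close> has expelled the \<open>z\<close> that replaced
      \<open>p\<close>, so \<open>y\<close> meets the first old entry beyond
      \<open>p\<close>.\<close>
    have y2: "least_ge (put (put C z) x) y = q"
    proof (rule least_ge_eqI)
      show "q \<in> put (put C z) x" using q pq True by (simp add: eq)
      fix w assume w: "w \<in> put (put C z) x" "y \<le> w"
      then have w': "w \<in> C" "w \<noteq> p" using assms by (auto simp: eq)
      then have "p \<le> w" using p(3)[of w] w assms by simp
      then show "q \<le> w" using q(3)[of w] w' True by simp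
    qed (use assms q in auto)
    have "z \<notin> C \<or> z = p" "x \<notin> C \<or> x = p"
      using p(2) p(3)[of z] p(3)[of x] True assms by auto
    moreover have "put (put (put C x) z) y = insert y (put (put C x) z - {z})"
      by (simp only: put_def[of "put (put C x) z"] y1)
    moreover have "put (put C x) z = insert z (put C x - {q})"
      by (simp only: put_def[of "put C x"] q_def)
    moreover have "put C x = insert x (C - {p})"
      by (simp only: put_def p_def)
    moreover have "put (put (put C z) x) y = insert y (put (put C z) x - {q})"
      by (simp only: put_def[of "put (put C z) x"] y2)
    ultimately have "put (put (put C x) z) y = put (put (put C z) x) y"
      using True pq assms q(2) eq by auto
    then show ?thesis
      using plactic_xzy[of z p q "[]"] True pq y1 y2 by (simp flip: p_def q_def)
  next
    case False
    have [simp]: "least_ge C z = q"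
      using q False by (intro least_ge_eqI) auto
    have [simp]: "least_ge (put C z) x = p"
      using p q pq False assms by (intro least_ge_eqI) (auto simp: put_def)
    have "put (put C x) z = insert z (insert x (C - {p}) - {q})"
      by (simp only: put_def[of "put C x"] q_def) (simp only: put_def p_def)
    moreover have "put (put C z) x = insert x (insert z (C - {q}) - {p})"
      by (simp add: put_def[of "put C z"]) (simp add: put_def)
    ultimately have eq: "put (put C x) z = put (put C z) x"
      and E: "put (put C z) x = insert x (insert z (C - {p} - {q}))"
      using p q pq False assms by auto
    define r where "r = least_ge (put (put C z) x) y"
    have r: "r \<in> put (put C z) x" "y \<le> r"
      using least_ge[OF infinite_put[OF infinite_put[OF assms(1)]]] by (auto simp: r_def)
    have "r \<le> z"
      unfolding r_def using False assms by (intro least_ge_le) (auto simp: E)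
    moreover have "p < r"
      using r p(3)[of r] assms False unfolding E by auto
    ultimately have "r # q # [p] \<sim> r # p # [q]"
      using q by (intro plactic_yzx) auto
    then show ?thesis using eq by (simp flip: r_def p_def q_def)
  qed
  from * show "fst (padded_cross C [y, z, x]) = fst (padded_cross C [y, x, z])" by simp
  from * show "snd (padded_cross C [y, z, x]) \<sim> snd (padded_cross C [y, x, z])" by simp
qed

lemma padded_cross_context:
  assumes "\<And>C. infinite C \<Longrightarrow> fst (padded_cross C u) = fst (padded_cross C v)"
    and "\<And>C. infinite C \<Longrightarrow> snd (padded_cross C u) \<sim> snd (padded_cross C v)"
    and "infinite C"
  shows "fst (padded_cross C (a @ u @ b)) = fst (padded_cross C (a @ v @ b)) \<and>
    snd (padded_cross C (a @ u @ b)) \<sim> snd (padded_cross C (a @ v @ b))"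
  using assms(1,2)[OF infinite_padded_cross[OF assms(3), of b]]
  by (auto simp: padded_cross_append case_prod_beta intro!: plactic_context)

lemma padded_cross_plactic:
  assumes "u \<sim> v" "infinite C"
  shows "fst (padded_cross C u) = fst (padded_cross C v) \<and>
    snd (padded_cross C u) \<sim> snd (padded_cross C v)"
  using assms(1)
proof (induction rule: plactic_induct)
  case (knuth u v)
  then show ?case
  proof cases
    case (knuth_left x y z a b)
    then show ?thesis
      using padded_cross_context[of "[x, z, y]"] padded_cross_xzy assms(2) by metis
  next
    case (knuth_right x y z a b)
    then show ?thesis
      using padded_cross_context[of "[y, z, x]"] padded_cross_yzx assms(2) by metis
  qed
qed (auto intro: plactic_sym plactic_trans)

text \<open>Appending a letter to the actual column corresponds to expelling a padding letter, that
  is, one that is at least \<open>N\<close>.\<close>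

lemma bump_padded:
  assumes "sorted_wrt (<) c" "infinite C" "set c = C \<inter> {..<N}" "x < N"
    "bump (\<le>) x c = (c', b)"
  shows "sorted_wrt (<) c' \<and> set c' = put C x \<inter> {..<N} \<and>
    b = (if least_ge C x < N then Some (least_ge C x) else None)"
proof (cases b)
  case None
  then have c': "c' = c @ [x]" "\<forall>z\<in>set c. z < x" using bump_NoneD[of "(\<le>)" x c c'] assms(5) by auto
  then have "\<not> least_ge C x < N"
    using least_ge[OF assms(2), of x] assms(3) by (metis IntI lessThan_iff not_le)
  then show ?thesis using c' assms None by (auto simp: sorted_wrt_append put_def)
next
  case (Some y)
  then obtain a e where c: "c = a @ y # e" "c' = a @ x # e" "x \<le> y" "\<forall>z\<in>set a. z < x"
    using bump_SomeD[of "(\<le>)" x c c' y] assms(5) by (auto simp: not_le)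
  have y: "y \<in> C" "y < N" using c assms(3) by auto
  have "least_ge C x = y"
  proof (rule least_ge_eqI)
    fix z assume "z \<in> C" "x \<le> z"
    show "y \<le> z"
    proof (cases "z < N")
      case True
      with \<open>z \<in> C\<close> have "z \<in> set c" using assms(3) by auto
      then show ?thesis using c \<open>x \<le> z\<close> assms(1) by (auto simp: sorted_wrt_append)
    qed (use y in auto)
  qed (use y c in auto)
  moreover have "put C x \<inter> {..<N} = insert x (set c - {y})"
    using assms(3,4) \<open>least_ge C x = y\<close> by (auto simp: put_def)
  moreover have "set c' = insert x (set c - {y})"
    using c assms(1) by (auto simp: sorted_wrt_append)
  ultimately show ?thesis using c assms y Some by (force simp: sorted_wrt_append)
qed

lemma cross_padded:
  assumes "sorted_wrt (<) c" "infinite C" "set c = C \<inter> {..<N}" "set w \<subseteq> {..<N}"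
  shows "sorted_wrt (<) (fst (cross c w)) \<and>
    set (fst (cross c w)) = fst (padded_cross C w) \<inter> {..<N} \<and>
    snd (cross c w) = filter (\<lambda>x. x < N) (snd (padded_cross C w))"
  using assms(4)
proof (induction w)
  case (Cons x w)
  obtain c' b where b: "bump (\<le>) x (fst (cross c w)) = (c', b)" by fastforce
  have *: "sorted_wrt (<) c' \<and> set c' = put (fst (padded_cross C w)) x \<inter> {..<N} \<and>
    b = (if least_ge (fst (padded_cross C w)) x < N
         then Some (least_ge (fst (padded_cross C w)) x) else None)"
    by (rule bump_padded[OF _ _ _ _ b])
      (use Cons assms(2) in \<open>auto simp: infinite_padded_cross\<close>)
  show ?case using * b Cons by (auto simp: case_prod_beta)
qed (use assms in auto)

text \<open>All numbers from a bound \<open>N\<close> above the letters involved serve as padding.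
  Cutting at \<open>N\<close> turns the padded column and its expelled word back into the actual
  ones.\<close>

lemma cross_plactic:
  assumes "u \<sim> v" "sorted_wrt (<) c"
  shows "fst (cross c u) = fst (cross c v)" "snd (cross c u) \<sim> snd (cross c v)"
proof -
  define N where "N = Suc (Max (set u \<union> set v \<union> set c \<union> {0}))"
  have le: "x < N" if "x \<in> set u \<union> set v \<union> set c \<union> {0}" for x
    unfolding N_def using that by (simp only: less_Suc_eq_le) (intro Max_ge, auto)
  define C where "C = set c \<union> {N..}"
  have C: "infinite C" "set c = C \<inter> {..<N}"
    using le by (auto simp: C_def infinite_Ici)
  have u: "set u \<subseteq> {..<N}" and v: "set v \<subseteq> {..<N}" using le by auto
  note uv = padded_cross_plactic[OF assms(1) C(1)]
  note cu = cross_padded[OF assms(2) C u] and cv = cross_padded[OF assms(2) C v]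
  show "fst (cross c u) = fst (cross c v)"
    using cu cv uv by (intro strict_sorted_equal) auto
  show "snd (cross c u) \<sim> snd (cross c v)"
    using cu cv uv by (auto intro: plactic_filter)
qed

lemma plactic_Nil: "u \<sim> v \<Longrightarrow> u = [] \<longleftrightarrow> v = []"
  by (induction rule: plactic_induct) (auto elim!: knuth.cases)

text \<open>Both words leave the same first column, and the words passed on to the remaining columns
  are equivalent and shorter.\<close>

lemma insert_left_S_l_plactic: "u \<sim> v \<Longrightarrow> insert_left S_l u [] = insert_left S_l v []"
proof (induction u arbitrary: v rule: length_induct)
  case (1 u)
  show ?case
  proof (cases "u = []")
    case False
    with plactic_Nil[OF 1(2)] have v: "v \<noteq> []" by simp
    have "insert_left S_l (snd (cross [] u)) [] = insert_left S_l (snd (cross [] v)) []"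
      using 1 length_cross_Nil[OF False] cross_plactic[of u v "[]"] by simp
    then show ?thesis
      using False v cross_plactic[of u v "[]"] 1(2)
      by (simp add: insert_left_S_l_empty insert_left_S_l_Cons)
  qed (use plactic_Nil[OF 1(2)] in simp)
qed

section \<open>Recovering a Young tableau from its reading\<close>

text \<open>The top of \<open>c\<close> enters first. When \<open>c ! i\<close> arrives, the entries
  above position \<open>i\<close> are the smaller ones of \<open>c\<close>, and
  \<open>d ! i\<close>, if present, is at least \<open>c ! i\<close>; so exactly position
  \<open>i\<close> is overwritten.\<close>

lemma cross_column:
  assumes "sorted_wrt (<) c" "\<forall>i<min (length c) (length d). c ! i \<le> d ! i"
  shows "cross d (rev c) = (c @ drop (length c) d, rev (take (length c) d))"
  using assms
proof (induction c rule: rev_induct)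
  case (snoc x c)
  have IH: "cross d (rev c) = (c @ drop (length c) d, rev (take (length c) d))"
  proof (rule snoc.IH)
    show "\<forall>i<min (length c) (length d). c ! i \<le> d ! i"
    proof (intro allI impI)
      fix i assume "i < min (length c) (length d)"
      then show "c ! i \<le> d ! i" using snoc.prems(2)[rule_format, of i] by (simp add: nth_append)
    qed
  qed (use snoc.prems in \<open>simp add: sorted_wrt_append\<close>)
  have less: "\<forall>z\<in>set c. \<not> x \<le> z" using snoc.prems by (auto simp: sorted_wrt_append)
  show ?case
  proof (cases "length c < length d")
    case True
    have "drop (length c) d = d ! length c # drop (Suc (length c)) d"
      using True by (simp add: Cons_nth_drop_Suc)
    moreover have "x \<le> d ! length c"
      using snoc.prems(2) True by (auto dest!: spec[of _ "length c"])
    ultimately show ?thesis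
      using IH True less by (simp add: bump_append take_Suc_conv_app_nth)
  next
    case False
    then show ?thesis using IH bump_append[of c "(\<le>)" x "[]"] less by simp
  qed
qed simp

lemma all_nat_iff: "(\<forall>k. P k) \<longleftrightarrow> P 0 \<and> (\<forall>k. P (Suc k))"
  by (metis not0_implies_Suc)

text \<open>\<open>P\<close> orders a line and \<open>Q\<close> compares neighbouring lines. Both
  the columns (\<open><\<close>, \<open>\<le>\<close>) and the rows (\<open>\<le>\<close>,
  \<open><\<close>) of a Young tableau are instances, and transposition exchanges the two.\<close>

definition tableau :: "(nat \<Rightarrow> nat \<Rightarrow> bool) \<Rightarrow> (nat \<Rightarrow> nat \<Rightarrow> bool) \<Rightarrow> nat \<Rightarrow> nat list list \<Rightarrow> bool" where
  "tableau P Q n xs \<longleftrightarrow> (\<forall>c\<in>set xs. c \<noteq> [] \<and> set c \<subseteq> {1..n} \<and> sorted_wrt P c) \<and>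
     (\<forall>k. Suc k < length xs \<longrightarrow> length (xs ! Suc k) \<le> length (xs ! k) \<and>
        (\<forall>i < length (xs ! Suc k). Q (xs ! k ! i) (xs ! Suc k ! i)))"

lemma Young_tableau: "t \<in> Young n \<longleftrightarrow> tableau (<) (\<le>) n t"
  by (simp add: Young_def tableau_def is_column_def)

lemma tableau_Nil [simp]: "tableau P Q n []"
  by (simp add: tableau_def)

lemma tableau_Cons:
  "tableau P Q n (c # xs) \<longleftrightarrow> c \<noteq> [] \<and> set c \<subseteq> {1..n} \<and> sorted_wrt P c \<and> tableau P Q n xs \<and>
     (xs \<noteq> [] \<longrightarrow> length (hd xs) \<le> length c \<and> (\<forall>i<length (hd xs). Q (c ! i) (hd xs ! i)))"
  unfolding tableau_def by (cases xs; subst all_nat_iff) auto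

lemma Young_Cons:
  "c # t \<in> Young n \<longleftrightarrow> is_column n c \<and> t \<in> Young n \<and>
     (t \<noteq> [] \<longrightarrow> length (hd t) \<le> length c \<and> (\<forall>i<length (hd t). c ! i \<le> hd t ! i))"
  by (auto simp: Young_tableau tableau_Cons is_column_def)

text \<open>The incoming column takes the place of the first one and expels it as an intact column
  word, so every column moves one place to the right.\<close>

lemma insert_left_S_l_column:
  assumes "c # t \<in> Young n"
  shows "insert_left S_l (rev c) t = c # t"
  using assms
proof (induction t arbitrary: c)
  case Nil
  then have c: "c \<noteq> []" "sorted_wrt (<) c" by (auto simp: Young_Cons is_column_def)
  then show ?case
    using cross_column[of c "[]"]
    by (simp add: insert_left_S_l_empty insert_left_S_l_Cons) (simp add: insert_left_def)
next
  case (Cons d t)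
  then have "cross d (rev c) = (c, rev d)"
    using cross_column[of c d] by (auto simp: Young_Cons is_column_def)
  then show ?case using Cons by (simp add: insert_left_S_l_Cons Young_Cons)
qed

lemma insert_left_append: "insert_left I (u @ v) d = insert_left I u (insert_left I v d)"
  by (simp add: insert_left_def)

lemma insert_left_S_l_reading: "t \<in> Young n \<Longrightarrow> insert_left S_l (R_SW t) [] = t"
proof (induction t)
  case Nil
  then show ?case by (simp add: R_SW_def insert_left_def)
next
  case (Cons c t)
  then have "insert_left S_l (R_SW t) [] = t" by (simp add: Young_Cons)
  then show ?case using insert_left_S_l_column[OF Cons.prems]
    by (simp add: R_SW_def insert_left_append)
qed

lemma Young_eqI:
  assumes "t \<in> Young n" "t' \<in> Young m" "R_SW t \<sim> R_SW t'"
  shows "t = t'"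
  using insert_left_S_l_plactic[OF assms(3)] insert_left_S_l_reading assms(1,2) by metis

subsection \<open>Jeu de taquin\<close>

text \<open>Empty cells are skipped, so that a column containing the hole can be read as
  well.\<close>

definition column :: "filling \<Rightarrow> nat \<Rightarrow> nat \<Rightarrow> nat \<Rightarrow> nat list" where
  "column T a b j = map (\<lambda>i. the (T (i, j))) (filter (\<lambda>i. T (i, j) \<noteq> None) [a..<b])"

text \<open>\<open>M\<close> and \<open>K\<close> are the height and width of a box around all
  filled cells. Slides stay inside it, so one pair serves the whole rectification.\<close>

definition reading :: "nat \<Rightarrow> nat \<Rightarrow> filling \<Rightarrow> nat list" where
  "reading M K T = concat (map (\<lambda>j. rev (column T 0 M j)) [0..<K])"

definition down_closed :: "cell set \<Rightarrow> bool" where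
  "down_closed S \<longleftrightarrow> (\<forall>i j i' j'. (i', j') \<in> S \<longrightarrow> i \<le> i' \<longrightarrow> j \<le> j' \<longrightarrow> (i, j) \<in> S)"

text \<open>
  All pairs of cells are compared, not only adjacent ones, so that the condition also relates cells
  separated by the hole of an unfinished slide.
\<close>

definition semistandard :: "filling \<Rightarrow> bool" where
  "semistandard T \<longleftrightarrow> (\<forall>i j i' j' a b. T (i, j) = Some a \<longrightarrow> T (i', j') = Some b \<longrightarrow>
     i \<le> i' \<longrightarrow> j \<le> j' \<longrightarrow> a \<le> b \<and> (i < i' \<longrightarrow> a < b))"

definition skew :: "nat \<Rightarrow> nat \<Rightarrow> nat \<Rightarrow> cell set \<Rightarrow> filling \<Rightarrow> bool" where
  "skew n M K \<mu> T \<longleftrightarrow> down_closed \<mu> \<and> down_closed (\<mu> \<union> dom T) \<and> dom T \<inter> \<mu> = {} \<and>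
     semistandard T \<and> ran T \<subseteq> {1..n} \<and> dom T \<subseteq> {..<M} \<times> {..<K}"

text \<open>The state in the middle of a slide: the corner has already left \<open>\<mu>\<close>,
  and the outer shape is required to be closed only with the hole included.\<close>

definition holed :: "nat \<Rightarrow> nat \<Rightarrow> nat \<Rightarrow> cell set \<Rightarrow> filling \<Rightarrow> cell \<Rightarrow> bool" where
  "holed n M K \<mu> T h \<longleftrightarrow> down_closed \<mu> \<and> down_closed (insert h (\<mu> \<union> dom T)) \<and>
     dom T \<inter> \<mu> = {} \<and> h \<notin> \<mu> \<and> T h = None \<and>
     semistandard T \<and> ran T \<subseteq> {1..n} \<and> dom T \<subseteq> {..<M} \<times> {..<K}"

lemma down_closedD: "down_closed S \<Longrightarrow> (i', j') \<in> S \<Longrightarrow> i \<le> i' \<Longrightarrow> j \<le> j' \<Longrightarrow> (i, j) \<in> S"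
  unfolding down_closed_def by blast

lemma semistandardD:
  "semistandard T \<Longrightarrow> T (i, j) = Some a \<Longrightarrow> T (i', j') = Some b \<Longrightarrow> i \<le> i' \<Longrightarrow> j \<le> j' \<Longrightarrow> a \<le> b"
  "semistandard T \<Longrightarrow> T (i, j) = Some a \<Longrightarrow> T (i', j') = Some b \<Longrightarrow> i < i' \<Longrightarrow> j \<le> j' \<Longrightarrow> a < b"
  unfolding semistandard_def by (blast dest: less_imp_le)+

lemma column_append: "a \<le> b \<Longrightarrow> b \<le> c \<Longrightarrow> column T a c j = column T a b j @ column T b c j"
  using upt_add_eq_append[of a b "c - b"] by (simp add: column_def)

lemma column_single: "column T i (Suc i) j = (case T (i, j) of None \<Rightarrow> [] | Some x \<Rightarrow> [x])"
  by (simp add: column_def split: option.split)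

lemma column_full:
  "(\<And>i. a \<le> i \<Longrightarrow> i < b \<Longrightarrow> T (i, j) \<noteq> None) \<Longrightarrow> column T a b j = map (\<lambda>i. the (T (i, j))) [a..<b]"
  unfolding column_def by (subst filter_True) auto

lemma column_empty: "(\<And>i. a \<le> i \<Longrightarrow> i < b \<Longrightarrow> T (i, j) = None) \<Longrightarrow> column T a b j = []"
  by (simp add: column_def)

lemma column_cong: "(\<And>i. a \<le> i \<Longrightarrow> i < b \<Longrightarrow> T (i, j) = T' (i, j)) \<Longrightarrow> column T a b j = column T' a b j"
  unfolding column_def by (intro map_cong filter_cong) auto

lemma column_at: "i < M \<Longrightarrow> column T 0 M j =
    column T 0 i j @ (case T (i, j) of None \<Rightarrow> [] | Some x \<Rightarrow> [x]) @ column T (Suc i) M j"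
  using column_append[of 0 i M T j] column_append[of i "Suc i" M T j]
  by (simp add: column_single)

lemma sorted_column: "semistandard T \<Longrightarrow> sorted_wrt (<) (column T a b j)"
  unfolding column_def sorted_wrt_map
  by (rule sorted_wrt_mono_rel[where P = "(<)"])
    (auto intro: semistandardD(2) sorted_wrt_filter)

lemma initial_segment:
  fixes P :: "nat \<Rightarrow> bool"
  assumes "\<And>k k'. k \<le> k' \<Longrightarrow> k' < b \<Longrightarrow> P k' \<Longrightarrow> P k"
  obtains c where "c \<le> b" "\<And>k. k < b \<Longrightarrow> P k \<longleftrightarrow> k < c"
proof (cases "\<exists>k<b. \<not> P k")
  case True
  then have "(LEAST k. \<not> P k) < b" by (meson Least_le le_less_trans)
  then show ?thesis
    using that[of "LEAST k. \<not> P k"] assms True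
    by (metis LeastI_ex less_imp_le_nat not_le not_less_Least)
qed (use that[of b] in auto)

text \<open>A cell weakly below and to the right of the hole is not in \<open>\<mu>\<close>, since
  otherwise the hole would be. Lying above and to the left of a filled cell, it belongs to the outer
  shape, and so it is filled unless it is the hole.\<close>

lemma holed_cell:
  assumes "holed n M K \<mu> T (i, j)" "T (i', j') = Some b" "k \<le> i'" "l \<le> j'"
    "i \<le> k" "j \<le> l" "(k, l) \<noteq> (i, j)"
  obtains a where "T (k, l) = Some a"
proof -
  have closed: "down_closed (insert (i, j) (\<mu> \<union> dom T))" "down_closed \<mu>" "(i, j) \<notin> \<mu>"
    using assms(1) by (simp_all add: holed_def)
  have "(i', j') \<in> insert (i, j) (\<mu> \<union> dom T)" using assms(2) by blast
  from down_closedD[OF closed(1) this assms(3,4)] have "(k, l) \<in> insert (i, j) (\<mu> \<union> dom T)" .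
  moreover have "(k, l) \<notin> \<mu>" using down_closedD[OF closed(2) _ assms(5,6)] closed(3) by blast
  ultimately show ?thesis using assms(7) that by blast
qed

section \<open>Invariants of a slide\<close>

text \<open>Only comparisons with the refilled cell are new. Entries in columns right of
  \<open>j\<close> are compared with \<open>y\<close> through the right neighbour \<open>x\<close>,
  which is where the choice \<open>y \<le> x\<close> enters.\<close>

lemma holed_down:
  assumes "holed n M K \<mu> T (i, j)" "T (Suc i, j) = Some y"
    "\<forall>x. T (i, Suc j) = Some x \<longrightarrow> y \<le> x"
  shows "holed n M K \<mu> (T((i, j) := Some y, (Suc i, j) := None)) (Suc i, j)"
proof -
  let ?T = "T((i, j) := Some y, (Suc i, j) := None)"
  note h = assms(1)[unfolded holed_def]
  have dom: "insert (Suc i, j) (\<mu> \<union> dom ?T) = insert (i, j) (\<mu> \<union> dom T)"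
    using assms(2) by (auto simp: domI)
  have below: "y < b" if "T (i', j') = Some b" "i < i'" "j \<le> j'" "(i', j') \<noteq> (Suc i, j)" for i' j' b
  proof (cases "j' = j")
    case True
    then show ?thesis using that h assms(2) semistandardD(2)[of T "Suc i" j y i' j' b] by auto
  next
    case False
    with that obtain x where "T (i, Suc j) = Some x"
      using holed_cell[OF assms(1), of i' j' b i "Suc j"] by force
    then show ?thesis using assms(3) that False h semistandardD(2)[of T i "Suc j" x i' j' b] by fastforce
  qed
  have right: "y \<le> b" if "T (i, j') = Some b" "j \<le> j'" for j' b
  proof -
    have "j < j'" using that h by (cases "j' = j") auto
    with that obtain x where "T (i, Suc j) = Some x"
      using holed_cell[OF assms(1), of i j' b i "Suc j"] by force
    then show ?thesis using assms(3) that \<open>j < j'\<close> h semistandardD(1)[of T i "Suc j" x i j' b] by fastforce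
  qed
  have above: "a < y" if "T (i', j') = Some a" "i' \<le> i" "j' \<le> j" for i' j' a
    using that h assms(2) semistandardD(2)[of T i' j' a "Suc i" j y] by auto
  have "semistandard ?T"
    unfolding semistandard_def
  proof (intro allI impI)
    fix i1 j1 i2 j2 a b
    assume *: "?T (i1, j1) = Some a" "?T (i2, j2) = Some b" "i1 \<le> i2" "j1 \<le> j2"
    consider "(i1, j1) = (i, j)" "(i2, j2) = (i, j)" | "(i1, j1) = (i, j)" "T (i2, j2) = Some b" "(i2, j2) \<noteq> (i, j)" "(i2, j2) \<noteq> (Suc i, j)"
      | "(i2, j2) = (i, j)" "T (i1, j1) = Some a" | "T (i1, j1) = Some a" "T (i2, j2) = Some b"
      using * by (auto split: if_splits)
    then show "a \<le> b \<and> (i1 < i2 \<longrightarrow> a < b)"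
    proof cases
      case 2
      then have "a = y" using * by (auto split: if_splits)
      then show ?thesis using 2 * below[of i2 j2 b] right[of j2 b] by (cases "i1 = i2") auto
    next
      case 3
      then have "b = y" using * by (auto split: if_splits)
      then show ?thesis using 3 * above[of i1 j1 a] by auto
    next
      case 4
      then show ?thesis using * h semistandardD[of T i1 j1 a i2 j2 b] by auto
    qed (use * in auto)
  qed
  moreover have "ran ?T \<subseteq> {1..n}" using h assms(2) unfolding ran_def by (auto split: if_splits)
  moreover have "dom ?T \<subseteq> {..<M} \<times> {..<K}"
  proof -
    have "(Suc i, j) \<in> {..<M} \<times> {..<K}" using h assms(2) by blast
    then show ?thesis using h by auto
  qed
  moreover have "(Suc i, j) \<notin> \<mu>" using h down_closedD[of \<mu> "Suc i" j i j] by auto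
  moreover have "dom ?T \<inter> \<mu> = {}" using h by auto
  ultimately show ?thesis using h dom unfolding holed_def by simp
qed

text \<open>Entries further down in column \<open>j\<close> are now compared with \<open>x\<close>
  through the lower neighbour \<open>y\<close>; taking the lower one in case of equality yields
  \<open>x < y\<close>, the strictness that a column demands.\<close>

lemma holed_across:
  assumes "holed n M K \<mu> T (i, j)" "T (i, Suc j) = Some x"
    "\<forall>y. T (Suc i, j) = Some y \<longrightarrow> x < y"
  shows "holed n M K \<mu> (T((i, j) := Some x, (i, Suc j) := None)) (i, Suc j)"
proof -
  let ?T = "T((i, j) := Some x, (i, Suc j) := None)"
  note h = assms(1)[unfolded holed_def]
  have dom: "insert (i, Suc j) (\<mu> \<union> dom ?T) = insert (i, j) (\<mu> \<union> dom T)"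
    using assms(2) by (auto simp: domI)
  have below: "x < b" if "T (i', j') = Some b" "i < i'" "j \<le> j'" for i' j' b
  proof (cases "j' = j")
    case True
    with that obtain y where "T (Suc i, j) = Some y"
      using holed_cell[OF assms(1), of i' j' b "Suc i" j] by force
    then show ?thesis using assms(3) that True h semistandardD(1)[of T "Suc i" j y i' j' b] by fastforce
  next
    case False
    then show ?thesis using that h assms(2) semistandardD(2)[of T i "Suc j" x i' j' b] by auto
  qed
  have right: "x \<le> b" if "T (i, j') = Some b" "j \<le> j'" for j' b
  proof -
    have "j < j'" using that h by (cases "j' = j") auto
    then show ?thesis using assms(2) that h semistandardD(1)[of T i "Suc j" x i j' b] by auto
  qed
  have above: "a \<le> x \<and> (i' < i \<longrightarrow> a < x)" if "T (i', j') = Some a" "i' \<le> i" "j' \<le> j" for i' j' a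
    using that h assms(2) semistandardD[of T i' j' a i "Suc j" x] by auto
  have "semistandard ?T"
    unfolding semistandard_def
  proof (intro allI impI)
    fix i1 j1 i2 j2 a b
    assume *: "?T (i1, j1) = Some a" "?T (i2, j2) = Some b" "i1 \<le> i2" "j1 \<le> j2"
    consider "(i1, j1) = (i, j)" "(i2, j2) = (i, j)" | "(i1, j1) = (i, j)" "T (i2, j2) = Some b" "(i2, j2) \<noteq> (i, j)"
      | "(i2, j2) = (i, j)" "T (i1, j1) = Some a" | "T (i1, j1) = Some a" "T (i2, j2) = Some b"
      using * by (auto split: if_splits)
    then show "a \<le> b \<and> (i1 < i2 \<longrightarrow> a < b)"
    proof cases
      case 2
      then have "a = x" using * by (auto split: if_splits)
      then show ?thesis using 2 * below[of i2 j2 b] right[of j2 b] by (cases "i1 = i2") auto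
    next
      case 3
      then have "b = x" using * by (auto split: if_splits)
      then show ?thesis using 3 * above[of i1 j1 a] by auto
    next
      case 4
      then show ?thesis using * h semistandardD[of T i1 j1 a i2 j2 b] by auto
    qed (use * in auto)
  qed
  moreover have "ran ?T \<subseteq> {1..n}" using h assms(2) unfolding ran_def by (auto split: if_splits)
  moreover have "dom ?T \<subseteq> {..<M} \<times> {..<K}"
  proof -
    have "(i, Suc j) \<in> {..<M} \<times> {..<K}" using h assms(2) by blast
    then show ?thesis using h by auto
  qed
  moreover have "(i, Suc j) \<notin> \<mu>" using h down_closedD[of \<mu> i "Suc j" i j] by auto
  moreover have "dom ?T \<inter> \<mu> = {}" using h by auto
  ultimately show ?thesis using h dom unfolding holed_def by simp
qed

lemma reading_down:
  assumes "holed n M K \<mu> T (i, j)" "T (Suc i, j) = Some y"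
  shows "reading M K (T((i, j) := Some y, (Suc i, j) := None)) = reading M K T"
proof -
  let ?T = "T((i, j) := Some y, (Suc i, j) := None)"
  have "(Suc i, j) \<in> {..<M} \<times> {..<K}" "T (i, j) = None"
    using assms unfolding holed_def by blast+
  then have "Suc i < M" by simp
  have split: "column T' 0 M j = column T' 0 i j @ column T' i (Suc i) j @
      column T' (Suc i) (Suc (Suc i)) j @ column T' (Suc (Suc i)) M j" for T'
    using \<open>Suc i < M\<close> column_append[of 0 i M T' j] column_append[of i "Suc i" M T' j]
      column_append[of "Suc i" "Suc (Suc i)" M T' j] by simp
  have "column ?T 0 i j = column T 0 i j" "column ?T (Suc (Suc i)) M j = column T (Suc (Suc i)) M j"
    by (auto intro!: column_cong)
  then have "column ?T 0 M j = column T 0 M j"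
    unfolding split[of ?T] split[of T] column_single
    using assms(2) \<open>T (i, j) = None\<close> by simp
  moreover have "column ?T 0 M k = column T 0 M k" if "k \<noteq> j" for k
    using that by (intro column_cong) auto
  ultimately have "column ?T 0 M k = column T 0 M k" for k by metis
  then show ?thesis by (simp add: reading_def)
qed

text \<open>Cut at row \<open>i\<close>, the columns \<open>j\<close> and \<open>j + 1\<close> give
  the words of \<open>plactic_slide\<close>, except for \<open>S1\<close>, the top part of the right
  column without neighbours in \<open>Q\<close>. It is read last in these two columns and is moved
  into the context \<open>B\<close>.\<close>

lemma reading_across:
  assumes "holed n M K \<mu> T (i, j)" "T (i, Suc j) = Some x"
    "\<forall>y. T (Suc i, j) = Some y \<longrightarrow> x < y"
  shows "reading M K (T((i, j) := Some x, (i, Suc j) := None)) \<sim> reading M K T"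
proof -
  define T' where "T' = T((i, j) := Some x, (i, Suc j) := None)"
  note h = assms(1)[unfolded holed_def]
  have ss: "semistandard T" "semistandard T'"
    using h holed_across[OF assms] unfolding T'_def holed_def by auto
  have "(i, Suc j) \<in> {..<M} \<times> {..<K}" using h assms(2) by blast
  then have iM: "i < M" and jK: "Suc j < K" by auto
  define Q where "Q = column T 0 i j"
  define P where "P = column T (Suc i) M j"
  define S where "S = column T 0 i (Suc j)"
  define R where "R = column T (Suc i) M (Suc j)"
  have cT: "column T 0 M j = Q @ P" "column T 0 M (Suc j) = S @ x # R"
    unfolding Q_def P_def S_def R_def using column_at[OF iM, of T] h assms(2) by auto
  have "column T' 0 i j = Q" "column T' (Suc i) M j = P"
    "column T' 0 i (Suc j) = S" "column T' (Suc i) M (Suc j) = R"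
    unfolding Q_def P_def S_def R_def T'_def by (auto intro!: column_cong)
  then have cT': "column T' 0 M j = Q @ x # P" "column T' 0 M (Suc j) = S @ R"
    using column_at[OF iM, of T'] by (auto simp: T'_def)
  have other: "column T' 0 M k = column T 0 M k" if "k \<noteq> j" "k \<noteq> Suc j" for k
    using that unfolding T'_def by (intro column_cong) auto
  have below: "T (k, j') \<noteq> None" if "T (k', j'') \<noteq> None" "i < k" "k \<le> k'" "j' \<le> j''" "j \<le> j'" for k k' j' j''
    using that holed_cell[OF assms(1), of k' j'' _ k j'] by fastforce
  have above: "T (k', j'') \<noteq> None" if "T (k, j') \<noteq> None" "k \<le> k'" "k' < i" "j' \<le> j''" "j'' \<le> Suc j" for k k' j' j''
  proof -
    have "down_closed (insert (i, j) (\<mu> \<union> dom T))" "down_closed \<mu>" using h by simp_all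
    note closed = down_closedD[OF this(1)] down_closedD[OF this(2)]
    have "(i, Suc j) \<in> insert (i, j) (\<mu> \<union> dom T)" using assms(2) by blast
    then have "(k', j'') \<in> insert (i, j) (\<mu> \<union> dom T)"
      using that by (elim closed(1)) simp_all
    moreover have "(k, j') \<notin> \<mu>" using h that(1) by blast
    then have "(k', j'') \<notin> \<mu>" using closed(2) that(2,4) by blast
    ultimately show ?thesis using that(3) by blast
  qed
  \<comment> \<open>\<open>q\<close> is the first row above the hole that column \<open>j\<close>
    occupies, or \<open>i\<close> if there is none.\<close>
  obtain q where q: "q \<le> i" "\<And>k. k < i \<Longrightarrow> T (k, j) = None \<longleftrightarrow> k < q"
    using initial_segment[of i "\<lambda>k. T (k, j) = None"] above[of _ j _ j]
    by (metis le_Suc_eq order_refl)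
  have Q: "Q = map (\<lambda>k. the (T (k, j))) [q..<i]"
    unfolding Q_def using column_append[of 0 q i T j] q column_empty[of 0 q T j] column_full[of q i T j]
    by auto
  define S1 where "S1 = column T 0 q (Suc j)"
  define S2 where "S2 = column T q i (Suc j)"
  have S: "S = S1 @ S2" unfolding S_def S1_def S2_def using q by (intro column_append) auto
  have S2: "S2 = map (\<lambda>k. the (T (k, Suc j))) [q..<i]"
    unfolding S2_def
  proof (intro column_full)
    fix k assume k: "q \<le> k" "k < i"
    then have "T (k, j) \<noteq> None" using q by auto
    then show "T (k, Suc j) \<noteq> None" using above[of k j k "Suc j"] k by auto
  qed
  have QS: "list_all2 (\<le>) Q S2"
    unfolding Q S2 list_all2_map1 list_all2_map2
  proof (rule list_all2_same[THEN iffD2], intro ballI)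
    fix k assume k: "k \<in> set [q..<i]"
    then obtain a where a: "T (k, j) = Some a" using q by fastforce
    then obtain b where b: "T (k, Suc j) = Some b" using above[of k j k "Suc j"] k by auto
    show "the (T (k, j)) \<le> the (T (k, Suc j))"
      using semistandardD(1)[OF ss(1) a b] a b by simp
  qed
  obtain p where p: "p \<le> M - Suc i" "\<And>k. k < M - Suc i \<Longrightarrow> T (Suc i + k, j) \<noteq> None \<longleftrightarrow> k < p"
    by (rule initial_segment[of "M - Suc i" "\<lambda>k. T (Suc i + k, j) \<noteq> None"])
      (use below[of _ j _ j] in auto)
  obtain r where r: "r \<le> M - Suc i" "\<And>k. k < M - Suc i \<Longrightarrow> T (Suc i + k, Suc j) \<noteq> None \<longleftrightarrow> k < r"
    by (rule initial_segment[of "M - Suc i" "\<lambda>k. T (Suc i + k, Suc j) \<noteq> None"])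
      (use below[of _ "Suc j" _ "Suc j"] in auto)
  have seg: "column T (Suc i) M j' = map (\<lambda>k. the (T (k, j'))) [Suc i..<Suc i + s]"
    if s: "s \<le> M - Suc i" and iff: "\<And>k. k < M - Suc i \<Longrightarrow> T (Suc i + k, j') \<noteq> None \<longleftrightarrow> k < s" for s j'
  proof -
    have "T (k, j') \<noteq> None" if "Suc i \<le> k" "k < Suc i + s" for k
      using s that iff[of "k - Suc i"] by auto
    moreover have "T (k, j') = None" if "Suc i + s \<le> k" "k < M" for k
    proof -
      have "\<not> k - Suc i < s" "k - Suc i < M - Suc i" "Suc i + (k - Suc i) = k" using that by auto
      then show ?thesis using iff[of "k - Suc i"] by metis
    qed
    ultimately show ?thesis
      using column_append[of "Suc i" "Suc i + s" M T j'] s iM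
        column_full[of "Suc i" "Suc i + s" T j'] column_empty[of "Suc i + s" M T j'] by auto
  qed
  have PR: "P = map (\<lambda>k. the (T (k, j))) [Suc i..<Suc i + p]"
    "R = map (\<lambda>k. the (T (k, Suc j))) [Suc i..<Suc i + r]"
    unfolding P_def R_def using seg[OF p] seg[OF r] by auto
  have len: "length P = p" "length R = r" unfolding PR length_map length_upt by simp_all
  have rp: "r \<le> p"
  proof (cases r)
    case (Suc m)
    then have "T (Suc i + m, Suc j) \<noteq> None" using r by auto
    then have "T (Suc i + m, j) \<noteq> None" using below[of "Suc i + m" "Suc j" "Suc i + m" j] by auto
    then show ?thesis using p(2)[of m] r(1) Suc by auto
  qed simp
  have le: "P ! k \<le> R ! k" if "k < length R" for k
  proof -
    have k: "k < r" using that len by simp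
    then obtain a b where "T (Suc i + k, j) = Some a" "T (Suc i + k, Suc j) = Some b"
      using p r rp by fastforce
    then show ?thesis
      using semistandardD(1)[OF ss(1), of "Suc i + k" j a "Suc i + k" "Suc j" b] k rp
      by (simp add: PR del: upt_Suc)
  qed
  \<comment> \<open>\<open>Q @ x # P\<close> is column \<open>j\<close> after the move, so its order
    comes from \<open>T'\<close> being semistandard.\<close>
  have "sorted_wrt (<) (S @ x # R)" "sorted_wrt (<) (Q @ x # P)"
    using sorted_column[OF ss(1), of 0 M "Suc j"] sorted_column[OF ss(2), of 0 M j] cT cT' by auto
  then have slide: "rev P @ rev Q @ rev R @ x # rev S2 \<sim> rev P @ x # rev Q @ rev R @ rev S2"
    using le rp len QS by (intro plactic_slide) (auto simp: S sorted_wrt_append)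
  have upt: "[0..<K] = [0..<j] @ [j, Suc j] @ [Suc (Suc j)..<K]"
    using jK upt_add_eq_append[of 0 j "K - j"] by (simp add: upt_conv_Cons)
  define A where "A = concat (map (\<lambda>k. rev (column T 0 M k)) [0..<j])"
  define B where "B = rev S1 @ concat (map (\<lambda>k. rev (column T 0 M k)) [Suc (Suc j)..<K])"
  have "map (\<lambda>k. rev (column T' 0 M k)) [0..<j] = map (\<lambda>k. rev (column T 0 M k)) [0..<j]"
    "map (\<lambda>k. rev (column T' 0 M k)) [Suc (Suc j)..<K] = map (\<lambda>k. rev (column T 0 M k)) [Suc (Suc j)..<K]"
    by (auto simp: other)
  then have "reading M K T' = A @ (rev P @ x # rev Q @ rev R @ rev S2) @ B"
    unfolding reading_def upt A_def B_def by (simp add: cT' S del: map_eq_conv)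
  moreover have "reading M K T = A @ (rev P @ rev Q @ rev R @ x # rev S2) @ B"
    unfolding reading_def upt A_def B_def by (simp add: cT S)
  ultimately show ?thesis
    using plactic_context[OF plactic_sym[OF slide], of A B] by (simp add: T'_def)
qed

lemma forward_slide_skew:
  "forward_slide T h T' \<Longrightarrow> holed n M K \<mu> T h \<Longrightarrow> skew n M K \<mu> T' \<and> reading M K T' \<sim> reading M K T"
proof (induction rule: forward_slide.induct)
  case (stop T h)
  obtain i j where h: "h = (i, j)" by fastforce
  note H = stop(3)[unfolded holed_def h]
  then have closed: "down_closed \<mu>" "(i, j) \<notin> \<mu>" "T (i, j) = None"
    "down_closed (insert (i, j) (\<mu> \<union> dom T))" by simp_all
  have none: "(Suc i, j) \<notin> insert (i, j) (\<mu> \<union> dom T)" "(i, Suc j) \<notin> insert (i, j) (\<mu> \<union> dom T)"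
    using stop(1,2) down_closedD[of \<mu> "Suc i" j i j] down_closedD[of \<mu> i "Suc j" i j]
      closed by (auto simp: h domIff)
  have "down_closed (\<mu> \<union> dom T)"
    unfolding down_closed_def
  proof (intro allI impI)
    fix i1 j1 i2 j2 assume *: "(i2, j2) \<in> \<mu> \<union> dom T" "i1 \<le> i2" "j1 \<le> j2"
    then have L: "(i2, j2) \<in> insert (i, j) (\<mu> \<union> dom T)" by blast
    with * have "(i1, j1) \<in> insert (i, j) (\<mu> \<union> dom T)"
      using down_closedD[OF closed(4)] by blast
    moreover have "(i1, j1) \<noteq> (i, j)"
    proof
      assume eq: "(i1, j1) = (i, j)"
      have "(i2, j2) \<noteq> (i, j)" using * closed by (auto simp: domIff)
      then have "Suc i \<le> i2 \<and> j \<le> j2 \<or> i \<le> i2 \<and> Suc j \<le> j2" using * eq by auto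
      then show False using none down_closedD[OF closed(4) L] by blast
    qed
    ultimately show "(i1, j1) \<in> \<mu> \<union> dom T" by auto
  qed
  then show ?case using H by (auto simp: skew_def)
next
  case (down T h y T')
  obtain i j where h: "h = (i, j)" by fastforce
  note T = down.prems[unfolded h] down.hyps(1,2)[unfolded h lower.simps right.simps]
  show ?case
    using down.IH[unfolded h lower.simps, OF holed_down[OF T]] reading_down[OF T(1,2)] by metis
next
  case (across T h x T')
  obtain i j where h: "h = (i, j)" by fastforce
  note T = across.prems[unfolded h] across.hyps(1,2)[unfolded h lower.simps right.simps]
  show ?case
    using across.IH[unfolded h right.simps, OF holed_across[OF T]] reading_across[OF T]
    by (blast intro: plactic_trans)
qed

text \<open>Each step raises the coordinate sum of the hole by one, and the hole only moves to
  filled cells, which lie in the box.\<close>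

lemma forward_slide_exists: "holed n M K \<mu> T h \<Longrightarrow> \<exists>T'. forward_slide T h T'"
proof (induction "M + K - (fst h + snd h)" arbitrary: T h rule: less_induct)
  case less
  obtain i j where h: "h = (i, j)" by fastforce
  have bound: "i' < M" "j' < K" if "T (i', j') = Some x" for i' j' x
    using less.prems that unfolding holed_def by blast+
  consider (stop) "T (lower h) = None" "T (right h) = None"
    | (down) y where "T (lower h) = Some y" "\<forall>x. T (right h) = Some x \<longrightarrow> y \<le> x"
    | (across) x where "T (right h) = Some x" "\<forall>y. T (lower h) = Some y \<longrightarrow> x < y"
    by (cases "T (lower h)"; cases "T (right h)") (auto, metis not_le)
  then show ?case
  proof cases
    case stop
    then show ?thesis using forward_slide.stop by blast
  next
    case down
    have "\<exists>T'. forward_slide (T(h := Some y, lower h := None)) (lower h) T'"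
      using down less.prems holed_down[of n M K \<mu> T i j y] bound[of "Suc i" j y]
      by (intro less.hyps) (auto simp: h)
    then show ?thesis using forward_slide.down down by blast
  next
    case across
    have "\<exists>T'. forward_slide (T(h := Some x, right h := None)) (right h) T'"
      using across less.prems holed_across[of n M K \<mu> T i j x] bound[of i "Suc j" x]
      by (intro less.hyps) (auto simp: h)
    then show ?thesis using forward_slide.across across by blast
  qed
qed

lemma inner_corner_holed:
  assumes "skew n M K \<mu> T" "inner_corner \<mu> h"
  shows "holed n M K (\<mu> - {h}) T h"
proof -
  obtain i j where h: "h = (i, j)" by fastforce
  note S = assms(1)[unfolded skew_def]
  have c: "(i, j) \<in> \<mu>" "(Suc i, j) \<notin> \<mu>" "(i, Suc j) \<notin> \<mu>"
    using assms(2) by (auto simp: inner_corner_def h)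
  have "down_closed (\<mu> - {h})"
    unfolding down_closed_def
  proof (intro allI impI)
    fix i1 j1 i2 j2 assume *: "(i2, j2) \<in> \<mu> - {h}" "i1 \<le> i2" "j1 \<le> j2"
    then have L: "(i2, j2) \<in> \<mu>" by simp
    have "down_closed \<mu>" using S by simp
    note closed = down_closedD[OF this L]
    have "(i1, j1) \<in> \<mu>" using closed * by simp
    moreover have "(i1, j1) \<noteq> (i, j)"
    proof
      assume eq: "(i1, j1) = (i, j)"
      then have "Suc i \<le> i2 \<and> j \<le> j2 \<or> i \<le> i2 \<and> Suc j \<le> j2"
        using * h by (cases "i = i2") auto
      then show False using c closed by blast
    qed
    ultimately show "(i1, j1) \<in> \<mu> - {h}" by (simp add: h)
  qed
  moreover have "insert h (\<mu> - {h} \<union> dom T) = \<mu> \<union> dom T" using c h by auto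
  moreover have "T h = None" using S c h by auto
  ultimately show ?thesis using S unfolding holed_def by auto
qed

lemma jdt_skew:
  assumes "jdt\<^sup>*\<^sup>* (\<mu>, T) (\<mu>', T')" "skew n M K \<mu> T" "finite \<mu>"
  shows "skew n M K \<mu>' T' \<and> finite \<mu>' \<and> reading M K T' \<sim> reading M K T"
  using assms(1)
proof (induction "(\<mu>', T')" arbitrary: \<mu>' T' rule: rtranclp_induct)
  case base
  then show ?case using assms by simp
next
  case (step y)
  from step(2) obtain \<nu> U h where y: "y = (\<nu>, U)" "\<mu>' = \<nu> - {h}" "inner_corner \<nu> h" "forward_slide U h T'"
    by (auto elim: jdt.cases)
  have IH: "skew n M K \<nu> U" "finite \<nu>" "reading M K U \<sim> reading M K T" using step(3) y by auto
  show ?case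
    using forward_slide_skew[OF y(4) inner_corner_holed[OF IH(1) y(3)]] IH y(2)
    by (auto intro: plactic_trans)
qed

text \<open>A cell with the largest coordinate sum has neither its lower nor its right neighbour in
  the set.\<close>

lemma inner_corner_exists:
  assumes "finite \<mu>" "\<mu> \<noteq> {}"
  shows "\<exists>h. inner_corner \<mu> h"
proof -
  define m where "m = Max ((\<lambda>(i, j). i + j) ` \<mu>)"
  have "m \<in> (\<lambda>(i, j). i + j) ` \<mu>" unfolding m_def using assms by (intro Max_in) auto
  then obtain i j where ij: "(i, j) \<in> \<mu>" "i + j = m" by auto
  have "i' + j' \<le> m" if "(i', j') \<in> \<mu>" for i' j'
    unfolding m_def using assms that by (intro Max_ge) force+
  from this[of "Suc i" j] this[of i "Suc j"] ij have "inner_corner \<mu> (i, j)"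
    by (auto simp: inner_corner_def)
  then show ?thesis ..
qed

lemma jdt_terminates:
  assumes "finite \<mu>" "skew n M K \<mu> T"
  shows "\<exists>T'. jdt\<^sup>*\<^sup>* (\<mu>, T) ({}, T')"
  using assms
proof (induction "card \<mu>" arbitrary: \<mu> T)
  case 0
  then show ?case by auto
next
  case (Suc k)
  then obtain h where h: "inner_corner \<mu> h" using inner_corner_exists by fastforce
  note H = inner_corner_holed[OF Suc.prems(2) h]
  from forward_slide_exists[OF H] obtain U where U: "forward_slide T h U" by blast
  have "h \<in> \<mu>" using h by (simp add: inner_corner_def)
  then have "k = card (\<mu> - {h})" using Suc.hyps(2) by (metis card_Diff_singleton diff_Suc_1)
  then obtain T' where "jdt\<^sup>*\<^sup>* (\<mu> - {h}, U) ({}, T')"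
    using Suc.hyps(1)[of "\<mu> - {h}" U] Suc.prems(1) forward_slide_skew[OF U H] by auto
  then show ?case using jdt.intros[OF h U] by (meson converse_rtranclp_into_rtranclp)
qed

section \<open>Fillings and lists of columns\<close>

text \<open>The offsets \<open>s\<close> do not influence the reading, so the diagonal and the
  top-aligned placement are treated alike.\<close>

lemma reading_place:
  assumes "length d \<le> K" "\<And>j. j < length d \<Longrightarrow> s j + length (d ! j) \<le> M"
  shows "reading M K (place s d) = R_SW d"
proof -
  have col: "column (place s d) 0 M j = d ! j" if j: "j < length d" for j
  proof -
    let ?e = "s j + length (d ! j)"
    have "column (place s d) 0 M j = column (place s d) 0 (s j) j @
        column (place s d) (s j) ?e j @ column (place s d) ?e M j"
      using assms(2)[OF j] column_append[of 0 "s j" M "place s d" j]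
        column_append[of "s j" ?e M "place s d" j] by simp
    also have "column (place s d) 0 (s j) j = []" by (rule column_empty) (simp add: place_def)
    also have "column (place s d) ?e M j = []" by (rule column_empty) (simp add: place_def)
    also have "column (place s d) (s j) ?e j = map (\<lambda>i. the (place s d (i, j))) [s j..<?e]"
      using j by (intro column_full) (simp add: place_def)
    also have "\<dots> = d ! j" using j by (intro nth_equalityI) (auto simp: place_def)
    finally show ?thesis by simp
  qed
  have "column (place s d) 0 M j = []" if "length d \<le> j" for j
    using that by (intro column_empty) (simp add: place_def)
  then have "concat (map (\<lambda>j. rev (column (place s d) 0 M j)) [length d..<K]) = []" by simp
  moreover have "map (\<lambda>j. rev (column (place s d) 0 M j)) [0..<length d] = map rev d"
    by (intro nth_equalityI) (auto simp: col)
  moreover have "[0..<K] = [0..<length d] @ [length d..<K]"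
    using assms(1) upt_add_eq_append[of 0 "length d" "K - length d"] by simp
  ultimately show ?thesis by (simp add: reading_def R_SW_def)
qed

text \<open>Once \<open>\<mu>\<close> is empty the domain itself is closed, hence described by the
  column heights \<open>c j\<close> and the number \<open>w\<close> of nonempty columns.\<close>

lemma straight_place:
  assumes "skew n M K {} T"
  shows "\<exists>t. [] \<notin> set t \<and> T = place (\<lambda>_. 0) t"
proof -
  note S = assms[unfolded skew_def]
  have closed: "T (i, j) \<noteq> None" if "T (i', j') \<noteq> None" "i \<le> i'" "j \<le> j'" for i j i' j'
    using S down_closedD[of "dom T" i' j' i j] that by auto
  have bound: "T (i, j) = None" if "M \<le> i \<or> K \<le> j" for i j
  proof (rule ccontr)
    assume "T (i, j) \<noteq> None"
    then have "(i, j) \<in> {..<M} \<times> {..<K}" using S by blast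
    then show False using that by auto
  qed
  have "\<exists>c. \<forall>i. T (i, j) \<noteq> None \<longleftrightarrow> i < c" for j
    by (rule initial_segment[of M "\<lambda>i. T (i, j) \<noteq> None"])
      (use closed bound in \<open>auto, metis not_le order.strict_trans2 option.distinct(1)\<close>)
  then obtain c where c: "\<And>i j. T (i, j) \<noteq> None \<longleftrightarrow> i < c j" by metis
  obtain w where w: "\<And>j. T (0, j) \<noteq> None \<longleftrightarrow> j < w"
    by (rule initial_segment[of K "\<lambda>j. T (0, j) \<noteq> None"])
      (use closed bound in \<open>auto, metis not_le order.strict_trans2 option.distinct(1)\<close>)
  define t where "t = map (\<lambda>j. map (\<lambda>i. the (T (i, j))) [0..<c j]) [0..<w]"
  have "T (i, j) = place (\<lambda>_. 0) t (i, j)" for i j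
  proof (cases "T (i, j)")
    case None
    then show ?thesis using c[of i j] by (simp add: place_def t_def)
  next
    case (Some x)
    then have "i < c j" "j < w" using c[of i j] w[of j] closed[of i j 0 j] by auto
    then show ?thesis using Some by (simp add: place_def t_def)
  qed
  moreover have "c j \<noteq> 0" if "j < w" for j using c[of 0 j] w[of j] that by simp
  then have "[] \<notin> set t" unfolding t_def by fastforce
  ultimately show ?thesis by (intro exI[of _ t]) auto
qed

lemma straight_Young:
  assumes "skew n M K {} (place (\<lambda>_. 0) t)" "[] \<notin> set t"
  shows "t \<in> Young n" "reading M K (place (\<lambda>_. 0) t) = R_SW t"
proof -
  let ?T = "place (\<lambda>_. 0) t"
  note S = assms(1)[unfolded skew_def]
  have T: "?T (i, j) = (if j < length t \<and> i < length (t ! j) then Some (t ! j ! i) else None)" for i j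
    by (simp add: place_def)
  have "is_column n (t ! j)" if j: "j < length t" for j
    unfolding is_column_def
  proof (intro conjI)
    show "t ! j \<noteq> []" using assms(2) j nth_mem by metis
    show "set (t ! j) \<subseteq> {1..n}"
    proof
      fix x assume "x \<in> set (t ! j)"
      then obtain i where "i < length (t ! j)" "x = t ! j ! i" by (auto simp: in_set_conv_nth)
      then have "x \<in> ran ?T" using T[of i j] j by (auto intro: ranI)
      then show "x \<in> {1..n}" using S by auto
    qed
    show "sorted_wrt (<) (t ! j)"
      unfolding sorted_wrt_iff_nth_less
    proof (intro allI impI)
      fix i i' assume "i < i'" "i' < length (t ! j)"
      then show "t ! j ! i < t ! j ! i'"
        using semistandardD(2)[of ?T i j "t ! j ! i" i' j "t ! j ! i'"] S j by (simp add: T)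
    qed
  qed
  moreover have "length (t ! Suc k) \<le> length (t ! k) \<and> (\<forall>i<length (t ! Suc k). t ! k ! i \<le> t ! Suc k ! i)"
    if k: "Suc k < length t" for k
  proof -
    have len: "i < length (t ! k)" if "i < length (t ! Suc k)" for i
    proof -
      have "(i, Suc k) \<in> dom ?T" using that k T[of i "Suc k"] by auto
      then have "(i, k) \<in> dom ?T" using S down_closedD[of "dom ?T" i "Suc k" i k] by auto
      then show ?thesis by (auto simp: T split: if_splits)
    qed
    moreover have "t ! k ! i \<le> t ! Suc k ! i" if "i < length (t ! Suc k)" for i
      using semistandardD(1)[of ?T i k "t ! k ! i" i "Suc k" "t ! Suc k ! i"] S k len[OF that] that
      by (simp add: T)
    ultimately show ?thesis using len[of "length (t ! k)"] by (meson less_irrefl not_le)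
  qed
  ultimately show "t \<in> Young n"
    unfolding Young_def by (auto simp: in_set_conv_nth)
  have bound: "i < M \<and> j < K" if "j < length t" "i < length (t ! j)" for i j
  proof -
    have "(i, j) \<in> dom ?T" using that T[of i j] by auto
    then have "(i, j) \<in> {..<M} \<times> {..<K}" using S by blast
    then show ?thesis by simp
  qed
  show "reading M K ?T = R_SW t"
  proof (rule reading_place)
    show "length t \<le> K"
    proof (cases "length t")
      case (Suc m)
      then have "t ! m \<noteq> []" using assms(2) by (metis lessI nth_mem)
      then show ?thesis using bound[of m 0] Suc by simp
    qed simp
    fix j assume j: "j < length t"
    then have "t ! j \<noteq> []" using assms(2) by (metis nth_mem)
    then show "0 + length (t ! j) \<le> M" using bound[OF j, of "length (t ! j) - 1"] by (cases "t ! j") auto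
  qed
qed

section \<open>The diagonal shape as a skew shape\<close>

text \<open>Two different columns share at most one row: the bottom row of the right one,
  \<open>diag_top d j' + length (d ! j') - 1\<close>, is not below the top row of the left one,
  because \<open>length (d ! j') - 1\<close> is one of the summands of
  \<open>diag_top d j\<close>.\<close>

lemma diag_top_less:
  assumes "j < j'" "j' < length d" "d ! j' \<noteq> []"
  shows "diag_top d j' + length (d ! j') \<le> Suc (diag_top d j)"
proof -
  have "sum (\<lambda>m. length (d ! m) - 1) (insert j' {j'<..<length d}) \<le> diag_top d j"
    unfolding diag_top_def using assms by (intro sum_mono2) auto
  then show ?thesis using assms(3) by (cases "d ! j'") (auto simp: diag_top_def)
qed

lemma diag_top_Suc: "Suc j < length d \<Longrightarrow> diag_top d j = diag_top d (Suc j) + (length (d ! Suc j) - 1)"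
proof -
  assume "Suc j < length d"
  then have "{j<..<length d} = insert (Suc j) {Suc j<..<length d}" by auto
  then show ?thesis by (simp add: diag_top_def)
qed

text \<open>The defining condition concerns adjacent columns only. Columns further apart meet in a
  row only if all columns between them are single boxes, where top and bottom entry agree, so the
  adjacent inequalities form a chain.\<close>

lemma dSkew_row:
  assumes "d \<in> dSkew n" "j < j'" "j' < length d" "diag_top d j' + length (d ! j') = Suc (diag_top d j)"
  shows "hd (d ! j) \<le> last (d ! j')"
proof -
  have ne: "d ! k \<noteq> []" if "k < length d" for k
    using assms(1) that by (auto simp: dSkew_def is_column_def)
  have step: "hd (d ! k) \<le> last (d ! Suc k)" if "Suc k < length d" for k
    using assms(1) that by (simp add: dSkew_def)
  have "Suc j \<le> j'" using assms(2) by simp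
  then show ?thesis using assms(4)
  proof (induction "j' - Suc j" arbitrary: j)
    case 0
    then have "j' = Suc j" by simp
    then show ?case using step assms(3) by simp
  next
    case (Suc m)
    then have less: "Suc j < j'" by simp
    have one: "length (d ! Suc j) = 1" "diag_top d (Suc j) = diag_top d j"
      using diag_top_less[OF less assms(3) ne[OF assms(3)]] diag_top_Suc[of j d] Suc.prems less assms(3)
        ne[of "Suc j"] by (cases "d ! Suc j"; auto)+
    have "hd (d ! j) \<le> last (d ! Suc j)" using step less assms(3) by simp
    also have "\<dots> = hd (d ! Suc j)" using one(1) by (cases "d ! Suc j") auto
    also have "\<dots> \<le> last (d ! j')" using Suc less one by (intro Suc.hyps(1)) auto
    finally show ?case .
  qed
qed

lemma skew_diag_skew:
  assumes "d \<in> dSkew n"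
  shows "\<exists>M K. skew n M K (fst (diag_skew d)) (snd (diag_skew d)) \<and>
    reading M K (snd (diag_skew d)) = R_SW d"
proof -
  let ?s = "diag_top d" and ?T = "place (diag_top d) d"
  define \<mu> where "\<mu> = {(i, j). j < length d \<and> i < ?s j}"
  have col: "is_column n (d ! j)" if "j < length d" for j using assms that by (auto simp: dSkew_def)
  have ne: "d ! j \<noteq> []" if "j < length d" for j using col[OF that] by (simp add: is_column_def)
  have le: "?s j' + length (d ! j') \<le> ?s j + length (d ! j)" "?s j' \<le> ?s j"
    if "j \<le> j'" "j' < length d" for j j'
  proof -
    have "?s j' + length (d ! j') \<le> ?s j + length (d ! j) \<and> ?s j' \<le> ?s j"
    proof (cases "j = j'")
      case False
      then show ?thesis
        using diag_top_less[of j j' d] that ne[of j] ne[of j'] by (cases "d ! j"; cases "d ! j'") auto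
    qed simp
    then show "?s j' + length (d ! j') \<le> ?s j + length (d ! j)" "?s j' \<le> ?s j" by auto
  qed
  have T: "?T (i, j) = (if j < length d \<and> ?s j \<le> i \<and> i < ?s j + length (d ! j)
      then Some (d ! j ! (i - ?s j)) else None)" for i j
    by (simp add: place_def)
  have dom: "dom ?T = {(i, j). j < length d \<and> ?s j \<le> i \<and> i < ?s j + length (d ! j)}"
    by (auto simp: T split: if_splits)
  have "\<mu> \<union> dom ?T = {(i, j). j < length d \<and> i < ?s j + length (d ! j)}"
    unfolding dom \<mu>_def by auto
  moreover have "down_closed {(i, j). j < length d \<and> i < ?s j + length (d ! j)}"
    unfolding down_closed_def
  proof (intro allI impI)
    fix i j i' j'
    assume *: "(i', j') \<in> {(i, j). j < length d \<and> i < ?s j + length (d ! j)}" "i \<le> i'" "j \<le> j'"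
    then show "(i, j) \<in> {(i, j). j < length d \<and> i < ?s j + length (d ! j)}"
      using le(1)[of j j'] by auto
  qed
  ultimately have "down_closed (\<mu> \<union> dom ?T)" by simp
  moreover have "down_closed \<mu>"
    unfolding down_closed_def \<mu>_def
  proof (intro allI impI)
    fix i j i' j'
    assume *: "(i', j') \<in> {(i, j). j < length d \<and> i < ?s j}" "i \<le> i'" "j \<le> j'"
    then show "(i, j) \<in> {(i, j). j < length d \<and> i < ?s j}"
      using le(2)[of j j'] by auto
  qed
  moreover have "dom ?T \<inter> \<mu> = {}" unfolding dom \<mu>_def by auto
  moreover have "semistandard ?T"
    unfolding semistandard_def
  proof (intro allI impI)
    fix i j i' j' a b assume *: "?T (i, j) = Some a" "?T (i', j') = Some b" "i \<le> i'" "j \<le> j'"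
    then have j: "j < length d" "?s j \<le> i" "i < ?s j + length (d ! j)" "a = d ! j ! (i - ?s j)"
      and j': "j' < length d" "?s j' \<le> i'" "i' < ?s j' + length (d ! j')" "b = d ! j' ! (i' - ?s j')"
      by (auto simp: T split: if_splits)
    show "a \<le> b \<and> (i < i' \<longrightarrow> a < b)"
    proof (cases "j = j'")
      case True
      show ?thesis
      proof (cases "i = i'")
        case False
        then have "i - ?s j < i' - ?s j" "i' - ?s j < length (d ! j)"
          using True j j' * by auto
        then have "a < b"
          using True j(4) j'(4) col[OF j(1)] sorted_wrt_nth_less[of "(<)" "d ! j"]
          by (simp add: is_column_def)
        then show ?thesis by simp
      qed (use True j j' in simp)
    next
      case False
      \<comment> \<open>With \<open>i \<le> i'\<close>, cells of different columns can only be the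
        top of column \<open>j\<close> and the bottom of column \<open>j'\<close>, in their common
        row.\<close>
      then have eq: "i = ?s j" "i' = i" "?s j' + length (d ! j') = Suc (?s j)"
        using diag_top_less[of j j' d] ne[of j'] j j' * by auto
      then have "a = hd (d ! j)" using j ne[of j] by (simp add: hd_conv_nth)
      moreover have "i' - ?s j' = length (d ! j') - 1" using eq by simp
      then have "b = last (d ! j')" using j' ne[of j'] by (simp add: last_conv_nth)
      ultimately show ?thesis using dSkew_row[OF assms _ j'(1) eq(3)] False * eq by simp
    qed
  qed
  moreover have "ran ?T \<subseteq> {1..n}"
  proof
    fix x assume "x \<in> ran ?T"
    then obtain i j where "?T (i, j) = Some x" by (auto simp: ran_def)
    then have "j < length d" "x \<in> set (d ! j)" by (auto simp: T split: if_splits)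
    then show "x \<in> {1..n}" using col[of j] by (auto simp: is_column_def)
  qed
  moreover define M where "M = (\<Sum>j<length d. ?s j + length (d ! j))"
  have M: "?s j + length (d ! j) \<le> M" if "j < length d" for j
    unfolding M_def using that by (intro member_le_sum) auto
  then have "dom ?T \<subseteq> {..<M} \<times> {..<length d}" unfolding dom by fastforce
  ultimately have "skew n M (length d) \<mu> ?T" unfolding skew_def by blast
  moreover have "reading M (length d) ?T = R_SW d" using M by (intro reading_place) auto
  ultimately show ?thesis unfolding diag_skew_def \<mu>_def by auto
qed

lemma finite_diag_skew: "finite (fst (diag_skew d))"
proof -
  have "fst (diag_skew d) = (\<Union>j<length d. (\<lambda>i. (i, j)) ` {..<diag_top d j})"
    by (auto simp: diag_skew_def)
  then show ?thesis by simp
qed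

text \<open>Termination supplies an outcome, and all outcomes lie in the class of
  \<open>R_SW d\<close>, so they coincide. This gives the definite description its value.\<close>

lemma rect_Young:
  assumes "d \<in> dSkew n"
  shows "rect d \<in> Young n" "R_SW (rect d) \<sim> R_SW d"
proof -
  define \<mu> T where "\<mu> = fst (diag_skew d)" and "T = snd (diag_skew d)"
  have dT: "diag_skew d = (\<mu>, T)" by (simp add: \<mu>_def T_def)
  obtain M K where S: "skew n M K \<mu> T" "reading M K T = R_SW d"
    using skew_diag_skew[OF assms] by (auto simp: \<mu>_def T_def)
  have fin: "finite \<mu>" using finite_diag_skew by (simp add: \<mu>_def)
  define P where "P t \<longleftrightarrow> [] \<notin> set t \<and>
       (\<exists>\<mu>. jdt\<^sup>*\<^sup>* (diag_skew d) (\<mu>, place (\<lambda>_. 0) t) \<and> (\<nexists>h. inner_corner \<mu> h))" for t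
  have P: "t \<in> Young n \<and> R_SW t \<sim> R_SW d" if "P t" for t
  proof -
    obtain \<nu> where \<nu>: "jdt\<^sup>*\<^sup>* (\<mu>, T) (\<nu>, place (\<lambda>_. 0) t)" "\<nexists>h. inner_corner \<nu> h" and t: "[] \<notin> set t"
      using \<open>P t\<close> by (auto simp: P_def dT)
    note J = jdt_skew[OF \<nu>(1) S(1) fin]
    then have "\<nu> = {}" using inner_corner_exists \<nu>(2) by auto
    then show ?thesis using J straight_Young[of n M K t] t S(2) by simp
  qed
  obtain T' where T': "jdt\<^sup>*\<^sup>* (\<mu>, T) ({}, T')" using jdt_terminates[OF fin S(1)] by blast
  then obtain t where "[] \<notin> set t" "T' = place (\<lambda>_. 0) t"
    using straight_place jdt_skew[OF T' S(1) fin] by blast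
  then have "P t" using T' by (auto simp: P_def dT inner_corner_def)
  moreover have "t' = t" if "P t'" for t'
    using P[OF that] P[OF \<open>P t\<close>] Young_eqI[of t' n t n] plactic_sym plactic_trans by blast
  ultimately have "rect d = t"
    unfolding rect_def P_def[symmetric] by (rule the_equality)
  then show "rect d \<in> Young n" "R_SW (rect d) \<sim> R_SW d" using P[OF \<open>P t\<close>] by auto
qed

subsection \<open>Row insertion\<close>

definition add_line :: "'a list \<Rightarrow> 'a list list \<Rightarrow> 'a list list" where
  "add_line r cs = map (\<lambda>i. r ! i # (if i < length cs then cs ! i else [])) [0..<length r]"

lemma length_le_length_transpose: "x \<in> set xs \<Longrightarrow> length x \<le> length (transpose xs)"
  unfolding length_transpose by (induction xs) auto

lemma transpose_Cons_add_line:
  assumes "length (transpose xs) \<le> length c"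
  shows "transpose (c # xs) = add_line c (transpose xs)"
proof (rule nth_equalityI)
  show len: "length (transpose (c # xs)) = length (add_line c (transpose xs))"
    using assms by (simp add: length_transpose add_line_def)
  fix i assume "i < length (transpose (c # xs))"
  moreover from this len have "i < length c" by (simp add: add_line_def)
  moreover have "filter (\<lambda>x. i < length x) xs = []" if "length (transpose xs) \<le> i"
    using that length_le_length_transpose[of _ xs] by (fastforce simp: filter_empty_conv)
  ultimately show "transpose (c # xs) ! i = add_line c (transpose xs) ! i"
    by (simp add: nth_transpose add_line_def not_less)
qed

text \<open>Number and heads of the transposed lines are part of the induction because the next line
  \<open>c\<close> is compared with those heads; transitivity extends the comparison to whole
  lines.\<close>

lemma transpose_tableau:
  assumes "transp Q" "tableau P Q n xs"
  shows "tableau Q P n (transpose xs) \<and>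
    length (transpose xs) = (if xs = [] then 0 else length (hd xs)) \<and>
    (\<forall>i<length (transpose xs). hd (transpose xs ! i) = hd xs ! i)"
  using assms(2)
proof (induction xs)
  case (Cons c xs)
  let ?rows = "transpose xs"
  define tail where "tail i = (if i < length ?rows then ?rows ! i else [])" for i
  note C = Cons.prems[unfolded tableau_Cons]
  have IH: "tableau Q P n ?rows" "length ?rows = (if xs = [] then 0 else length (hd xs))"
    "\<And>i. i < length ?rows \<Longrightarrow> hd (?rows ! i) = hd xs ! i"
    using Cons.IH C by auto
  have len: "length ?rows \<le> length c" using IH(2) C by auto
  have eq: "transpose (c # xs) = map (\<lambda>i. c ! i # tail i) [0..<length c]"
    unfolding transpose_Cons_add_line[OF len] add_line_def tail_def ..
  have line: "set (c ! i # tail i) \<subseteq> {1..n} \<and> sorted_wrt Q (c ! i # tail i)" if i: "i < length c" for i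
  proof (cases "i < length ?rows")
    case True
    then have row: "?rows ! i \<noteq> []" "set (?rows ! i) \<subseteq> {1..n}" "sorted_wrt Q (?rows ! i)"
      using IH(1) nth_mem[OF True] unfolding tableau_def by auto
    have "Q (c ! i) (hd (?rows ! i))" using True IH(2,3) C by (auto split: if_splits)
    with row have "sorted_wrt Q (c ! i # ?rows ! i)"
      using assms(1) by (cases "?rows ! i") (auto dest: transpD)
    then show ?thesis using row True C nth_mem[OF i] by (auto simp: tail_def)
  next
    case False
    then show ?thesis using C nth_mem[OF i] by (auto simp: tail_def)
  qed
  have tail: "length (tail (Suc k)) \<le> length (tail k) \<and> (\<forall>m<length (tail (Suc k)). P (tail k ! m) (tail (Suc k) ! m))" for k
    using IH(1) unfolding tableau_def tail_def by auto
  have "tableau Q P n (transpose (c # xs))"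
    unfolding tableau_def
  proof (intro conjI allI impI ballI)
    fix r assume "r \<in> set (transpose (c # xs))"
    then obtain i where "i < length c" "r = c ! i # tail i" by (auto simp: eq)
    then show "r \<noteq> []" "set r \<subseteq> {1..n}" "sorted_wrt Q r" using line by auto
  next
    fix k assume "Suc k < length (transpose (c # xs))"
    then have k: "Suc k < length c" by (simp add: eq)
    then have rk: "transpose (c # xs) ! k = c ! k # tail k"
      "transpose (c # xs) ! Suc k = c ! Suc k # tail (Suc k)" by (simp_all add: eq del: upt_Suc)
    show "length (transpose (c # xs) ! Suc k) \<le> length (transpose (c # xs) ! k)"
      using tail[of k] by (simp add: rk)
    fix m assume "m < length (transpose (c # xs) ! Suc k)"
    then show "P (transpose (c # xs) ! k ! m) (transpose (c # xs) ! Suc k ! m)"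
      using tail[of k] k C sorted_wrt_nth_less[of P c k "Suc k"] by (cases m) (auto simp: rk)
  qed
  then show ?case by (simp add: eq)
qed simp

lemma tableau_length_le: "tableau P Q n (c # xs) \<Longrightarrow> x \<in> set xs \<Longrightarrow> length x \<le> length c"
proof (induction xs arbitrary: c)
  case (Cons d xs)
  then have "length d \<le> length c" "tableau P Q n (d # xs)" by (auto simp: tableau_Cons)
  then show ?case using Cons by (metis order_trans set_ConsD)
qed simp

lemma transpose_transpose_tableau:
  assumes "tableau P Q n xs"
  shows "transpose (transpose xs) = xs"
proof -
  have "sorted (rev (map length xs))"
    using assms
  proof (induction xs)
    case (Cons c xs)
    then show ?case using tableau_length_le[OF Cons.prems] by (auto simp: sorted_append tableau_Cons)
  qed simp
  moreover have "takeWhile (\<lambda>x. x \<noteq> []) xs = xs"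
    using assms by (simp add: takeWhile_eq_all_conv tableau_def)
  ultimately show ?thesis by (simp add: transpose_transpose)
qed

text \<open>Column reading and row reading, the latter from the bottom row up, are equivalent. The
  letters of the first row are gathered at the end: its first \<open>k\<close> letters jump over the
  column below \<open>r ! k\<close>, with \<open>r ! k\<close> as witness.\<close>

lemma plactic_rows_columns:
  assumes "tableau (\<le>) (<) n rs"
  shows "R_SW (transpose rs) \<sim> concat (rev rs)"
  using assms
proof (induction rs)
  case Nil
  then show ?case by (simp add: R_SW_def)
next
  case (Cons r rs)
  let ?cs = "transpose rs"
  define D where "D i = (if i < length ?cs then ?cs ! i else [])" for i
  note C = Cons.prems[unfolded tableau_Cons]
  have len: "length ?cs \<le> length r"
    using transpose_tableau[of "(<)" "(\<le>)" n rs] C by auto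
  have eq: "transpose (r # rs) = map (\<lambda>i. r ! i # D i) [0..<length r]"
    unfolding transpose_Cons_add_line[OF len] add_line_def D_def ..
  have "tableau (<) (\<le>) n (transpose (r # rs))"
    using transpose_tableau[OF _ Cons.prems] by simp
  then have col: "sorted_wrt (<) (r ! i # D i)" if "i < length r" for i
    using that unfolding tableau_def eq by auto
  have "concat (map (\<lambda>i. rev (D i) @ [r ! i]) [0..<k]) \<sim> concat (map (\<lambda>i. rev (D i)) [0..<k]) @ take k r"
    if "k \<le> length r" for k
    using that
  proof (induction k)
    case (Suc k)
    have take: "take (Suc k) r = take k r @ [r ! k]" using Suc by (simp add: take_Suc_conv_app_nth)
    have "sorted (take (Suc k) r)" using C by (simp add: sorted_wrt_take)
    then have "take k r @ rev (D k) @ [r ! k] \<sim> rev (D k) @ take k r @ [r ! k]"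
      using col[of k] Suc.prems by (intro plactic_row_past_column) (auto simp: take)
    from plactic_append_left[OF this, of "concat (map (\<lambda>i. rev (D i)) [0..<k])"]
    show ?case
      using plactic_append_right[OF Suc.IH, of "rev (D k) @ [r ! k]"] Suc.prems
      by (auto simp: take intro: plactic_trans)
  qed simp
  from this[of "length r"] have "R_SW (transpose (r # rs)) \<sim> concat (map (\<lambda>i. rev (D i)) [0..<length r]) @ r"
    by (simp add: R_SW_def eq o_def)
  also have "concat (map (\<lambda>i. rev (D i)) [0..<length r]) = R_SW ?cs"
  proof -
    have "[0..<length r] = [0..<length ?cs] @ [length ?cs..<length r]"
      using len upt_add_eq_append[of 0 "length ?cs" "length r - length ?cs"] by simp
    moreover have "map (\<lambda>i. rev (D i)) [0..<length ?cs] = map rev ?cs"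
      by (intro nth_equalityI) (auto simp: D_def)
    ultimately show ?thesis by (simp add: R_SW_def D_def)
  qed
  also have "R_SW ?cs @ r \<sim> concat (rev rs) @ r"
    using Cons.IH C by (intro plactic_append_right) auto
  finally show ?case by simp
qed

section \<open>Row bumping\<close>

text \<open>A positional form: \<open>p\<close> is the place where \<open>x\<close> ends up, and
  \<open>p = length l\<close> is the case of appending.\<close>

lemma bump_nth:
  assumes "bump r x l = (l', b)"
  obtains p where "p \<le> length l" "\<And>j. j < p \<Longrightarrow> \<not> r x (l ! j)"
    "length l' = max (length l) (Suc p)" "l' ! p = x" "\<And>j. j < length l \<Longrightarrow> j \<noteq> p \<Longrightarrow> l' ! j = l ! j"
    "b = (if p < length l then Some (l ! p) else None)" "p < length l \<Longrightarrow> r x (l ! p)"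
proof (cases b)
  case None
  with bump_NoneD[of r x l l'] assms show ?thesis
    by (intro that[of "length l"]) (auto simp: nth_append)
next
  case (Some y)
  with bump_SomeD[of r x l l' y] assms obtain a c
    where *: "l = a @ y # c" "l' = a @ x # c" "r x y" "\<forall>z\<in>set a. \<not> r x z" by auto
  then show ?thesis
    using Some by (intro that[of "length a"]) (auto simp: nth_append nth_Cons')
qed

lemma plactic_bump_row:
  assumes "sorted r" "bump (<) x r = (r', Some y)"
  shows "y # r' \<sim> r @ [x]"
proof -
  obtain a b where *: "r = a @ y # b" "r' = a @ x # b" "x < y" "\<forall>z\<in>set a. \<not> x < z"
    using bump_SomeD[OF assms(2)] by auto
  have "y # r' \<sim> (a @ [y, x]) @ b"
    using * assms(1) plactic_append_right[OF plactic_sym[OF plactic_past_row_left[of a x y]], of b]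
    by (auto simp: sorted_append not_less)
  also have "\<dots> \<sim> a @ y # b @ [x]"
    using * assms(1) plactic_append_left[OF plactic_sym[OF plactic_past_row_right[of y b x]], of a]
    by (auto simp: sorted_append)
  finally show ?thesis using * by simp
qed

lemma bump_row:
  assumes "sorted r" "bump (<) x r = (r', b)"
  shows "sorted r'" "set r' \<subseteq> insert x (set r)" "r' \<noteq> []" "set_option b \<subseteq> set r"
proof -
  have "sorted r' \<and> set r' \<subseteq> insert x (set r) \<and> r' \<noteq> [] \<and> set_option b \<subseteq> set r"
  proof (cases b)
    case None
    with bump_NoneD[of "(<)" x r r'] assms show ?thesis by (auto simp: sorted_append not_less)
  next
    case (Some y)
    with bump_SomeD[of "(<)" x r r' y] assms obtain a c
      where *: "r = a @ y # c" "r' = a @ x # c" "x < y" "\<forall>z\<in>set a. \<not> x < z" by auto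
    then show ?thesis using assms(1) Some by (force simp: sorted_append not_less)
  qed
  then show "sorted r'" "set r' \<subseteq> insert x (set r)" "r' \<noteq> []" "set_option b \<subseteq> set r" by auto
qed

text \<open>The bumped letter does not move to the right: if \<open>s\<close> reaches position
  \<open>p\<close>, then \<open>s ! p\<close> exceeds \<open>r ! p = y\<close>, whence
  \<open>q \<le> p\<close>. Above the place where \<open>y\<close> lands stands an entry at most
  \<open>x < y\<close>; elsewhere bumping has not raised the upper row.\<close>

lemma bump_below:
  assumes "sorted r" "length s \<le> length r" "\<forall>i<length s. r ! i < s ! i"
    and "bump (<) x r = (r', Some y)" "bump (<) y s = (s', b)"
  shows "length s' \<le> length r' \<and> (\<forall>i<length s'. r' ! i < s' ! i)"
proof -
  obtain p where p: "p \<le> length r" "\<And>j. j < p \<Longrightarrow> \<not> x < r ! j"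
    "length r' = max (length r) (Suc p)" "r' ! p = x" "\<And>j. j < length r \<Longrightarrow> j \<noteq> p \<Longrightarrow> r' ! j = r ! j"
    "Some y = (if p < length r then Some (r ! p) else None)" "p < length r \<Longrightarrow> x < r ! p"
    using bump_nth[OF assms(4)] by blast
  then have py: "p < length r" "r ! p = y" "x < y" by (auto split: if_splits)
  obtain q where q: "q \<le> length s" "\<And>j. j < q \<Longrightarrow> \<not> y < s ! j"
    "length s' = max (length s) (Suc q)" "s' ! q = y" "\<And>j. j < length s \<Longrightarrow> j \<noteq> q \<Longrightarrow> s' ! j = s ! j"
    using bump_nth[OF assms(5)] by blast
  have "q \<le> p"
  proof (rule ccontr)
    assume "\<not> q \<le> p"
    then have "p < length s" "\<not> y < s ! p" using q by auto
    then show False using assms(3) py by auto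
  qed
  have "r' ! i < s' ! i" if "i < length s'" for i
  proof (cases "i = q")
    case True
    have "r' ! q \<le> x" using p(2)[of q] p(4) p(5)[of q] py \<open>q \<le> p\<close> by (cases "q = p") auto
    then show ?thesis using True q py by simp
  next
    case False
    then have i: "i < length s" using that q by auto
    have "r' ! i \<le> r ! i" using p(4,5) py i assms(2) by (cases "i = p") auto
    also have "r ! i < s ! i" using assms(3) i by simp
    finally show ?thesis using q(5)[OF i False] by simp
  qed
  moreover have "length s' \<le> length r'" using q p py \<open>q \<le> p\<close> assms(2) by auto
  ultimately show ?thesis by simp
qed

lemma bump_below_None:
  assumes "length s \<le> length r" "\<forall>i<length s. r ! i < s ! i" "bump (<) x r = (r', None)"
  shows "length s \<le> length r' \<and> (\<forall>i<length s. r' ! i < s ! i)"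
  using bump_NoneD[OF assms(3)] assms(1,2) by (auto simp: nth_append)

lemma hd_schensted: "hd (schensted r ls x) = fst (bump r x (if ls = [] then [] else hd ls))"
  by (cases ls) (auto split: prod.splits option.splits)

text \<open>Since the rows are read from the bottom up, the letter \<open>y\<close>, expelled to the
  left of \<open>r'\<close>, stands directly behind the reading of the lower rows, into which it is
  inserted next.\<close>

lemma schensted_rows:
  assumes "tableau (\<le>) (<) n rs" "x \<in> {1..n}"
  shows "tableau (\<le>) (<) n (schensted (<) rs x) \<and>
    concat (rev (schensted (<) rs x)) \<sim> concat (rev rs) @ [x]"
  using assms
proof (induction rs arbitrary: x)
  case Nil
  then show ?case by (simp add: tableau_Cons)
next
  case (Cons r rs)
  note C = Cons.prems(1)[unfolded tableau_Cons]
  obtain r' b where b: "bump (<) x r = (r', b)" by fastforce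
  note r' = bump_row[OF _ b]
  show ?case
  proof (cases b)
    case None
    have "r' = r @ [x]" using bump_NoneD b None by blast
    then show ?thesis
      using bump_below_None[of "hd rs" r x r'] None b C r' Cons.prems(2)
      by (auto simp: tableau_Cons)
  next
    case (Some y)
    then have y: "y \<in> {1..n}" using r'(4) C by auto
    have IH: "tableau (\<le>) (<) n (schensted (<) rs y)"
      "concat (rev (schensted (<) rs y)) \<sim> concat (rev rs) @ [y]"
      using Cons.IH[OF _ y] C by auto
    \<comment> \<open>A missing next row counts as the empty row, so that opening a new row is a
      bump as well.\<close>
    define s where "s = (if rs = [] then [] else hd rs)"
    obtain s' b' where s': "bump (<) y s = (s', b')" by fastforce
    have "length s' \<le> length r' \<and> (\<forall>i<length s'. r' ! i < s' ! i)"
      using bump_below[of r s x r' y s' b'] C b Some s' by (auto simp: s_def split: if_splits)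
    moreover have "hd (schensted (<) rs y) = s'" using s' by (simp add: hd_schensted s_def)
    ultimately have "tableau (\<le>) (<) n (r' # schensted (<) rs y)"
      unfolding tableau_Cons using IH(1) r' C Cons.prems(2) by auto
    moreover have "concat (rev (schensted (<) rs y)) @ r' \<sim> concat (rev rs) @ y # r'"
      using plactic_append_right[OF IH(2), of r'] by simp
    then have "concat (rev (schensted (<) rs y)) @ r' \<sim> concat (rev rs) @ r @ [x]"
      using plactic_append_left[OF plactic_bump_row[of r x r' y]] C b Some
      by (meson plactic_trans)
    ultimately show ?thesis using b Some by simp
  qed
qed

lemma S_r_Young:
  assumes "t \<in> Young n" "x \<in> {1..n}"
  shows "S_r t x \<in> Young n" "R_SW (S_r t x) \<sim> R_SW t @ [x]"
proof -
  have t: "tableau (<) (\<le>) n t" using assms(1) by (simp add: Young_tableau)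
  then have rows: "tableau (\<le>) (<) n (transpose t)"
    using transpose_tableau[of "(\<le>)"] by (simp add: transp_on_le)
  note S = schensted_rows[OF rows assms(2)]
  then show "S_r t x \<in> Young n"
    using transpose_tableau[of "(<)"] by (simp add: Young_tableau S_r_def)
  have "R_SW (S_r t x) \<sim> concat (rev (schensted (<) (transpose t) x))"
    unfolding S_r_def using S by (intro plactic_rows_columns) auto
  also have "\<dots> \<sim> concat (rev (transpose t)) @ [x]" using S by simp
  also have "\<dots> \<sim> R_SW t @ [x]"
    using plactic_rows_columns[OF rows] transpose_transpose_tableau[OF t]
    by (intro plactic_append_right) (simp add: plactic_sym)
  finally show "R_SW (S_r t x) \<sim> R_SW t @ [x]" .
qed

lemma insert_right_S_r_Young:
  assumes "set w \<subseteq> {1..n}"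
  shows "insert_right S_r [] w \<in> Young n \<and> R_SW (insert_right S_r [] w) \<sim> w"
  using assms
proof (induction w rule: rev_induct)
  case Nil
  then show ?case by (simp add: insert_right_def Young_def R_SW_def)
next
  case (snoc x w)
  have "R_SW (insert_right S_r [] w) @ [x] \<sim> w @ [x]"
    using snoc by (intro plactic_append_right) auto
  then show ?case
    using snoc S_r_Young[of "insert_right S_r [] w" n x]
    by (auto simp: insert_right_def intro: plactic_trans)
qed

subsection \<open>Diagonal skew tableaux\<close>

lemma dSkew_Cons:
  "c # d \<in> dSkew n \<longleftrightarrow> is_column n c \<and> d \<in> dSkew n \<and> (d \<noteq> [] \<longrightarrow> hd c \<le> last (hd d))"
  unfolding dSkew_def mem_Collect_eq by (cases d; subst all_nat_iff) auto

lemma dSkew_append: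
  "d @ e \<in> dSkew n \<longleftrightarrow> d \<in> dSkew n \<and> e \<in> dSkew n \<and>
     (d \<noteq> [] \<longrightarrow> e \<noteq> [] \<longrightarrow> hd (last d) \<le> last (hd e))"
proof (induction d)
  case Nil
  then show ?case by (simp add: dSkew_def)
next
  case (Cons c d)
  then show ?case by (cases d) (auto simp: dSkew_Cons)
qed

lemma dSkew_Nil [simp]: "[] \<in> dSkew n"
  by (simp add: dSkew_def)

lemma I_l_a_dSkew:
  assumes "d \<in> dSkew n" "x \<in> {1..n}"
  shows "I_l_a d x \<in> dSkew n" "R_SW (I_l_a d x) = x # R_SW d"
proof -
  show "R_SW (I_l_a d x) = x # R_SW d" by (cases d) (auto simp: R_SW_def)
  show "I_l_a d x \<in> dSkew n"
  proof (cases d)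
    case (Cons c e)
    have c: "is_column n c" using assms(1) Cons by (simp add: dSkew_Cons)
    then have "z \<le> last c" if "z \<in> set c" for z
      using that by (cases c rule: rev_cases) (auto simp: is_column_def sorted_wrt_append)
    then show ?thesis
      using assms Cons c by (fastforce simp: dSkew_Cons is_column_def sorted_wrt_append)
  qed (use assms in \<open>simp add: dSkew_Cons is_column_def\<close>)
qed

lemma I_r_a_dSkew:
  assumes "d \<in> dSkew n" "x \<in> {1..n}"
  shows "I_r_a d x \<in> dSkew n" "R_SW (I_r_a d x) = R_SW d @ [x]"
proof -
  show "R_SW (I_r_a d x) = R_SW d @ [x]"
    by (cases d rule: rev_cases) (auto simp: R_SW_def I_r_a_def)
  show "I_r_a d x \<in> dSkew n"
  proof (cases d rule: rev_cases)
    case (snoc e c)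
    have c: "is_column n c" using assms(1) snoc by (simp add: dSkew_append dSkew_Cons)
    then have "hd c \<le> z" if "z \<in> set c" for z
      using that by (cases c) (auto simp: is_column_def)
    then show ?thesis
      using assms snoc c by (fastforce simp: I_r_a_def dSkew_append dSkew_Cons is_column_def)
  qed (use assms in \<open>simp add: I_r_a_def dSkew_Cons is_column_def\<close>)
qed

text \<open>Left concatenation realises every word as a reading. Applied to the reading of a Young
  tableau, this provides its preimage under \<open>rect\<close>.\<close>

lemma dSkew_of_word: "set w \<subseteq> {1..n} \<Longrightarrow> \<exists>d\<in>dSkew n. R_SW d = w"
proof (induction w)
  case Nil
  then show ?case by (intro bexI[of _ "[]"]) (auto simp: R_SW_def)
next
  case (Cons x w)
  then obtain d where "d \<in> dSkew n" "R_SW d = w" by auto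
  then show ?case using I_l_a_dSkew[of d n x] Cons.prems by auto
qed

lemma set_R_SW: "(\<And>c. c \<in> set d \<Longrightarrow> is_column n c) \<Longrightarrow> set (R_SW d) \<subseteq> {1..n}"
  by (auto simp: R_SW_def is_column_def)

lemma rect_eqI: "d \<in> dSkew n \<Longrightarrow> t \<in> Young n \<Longrightarrow> R_SW t \<sim> R_SW d \<Longrightarrow> rect d = t"
  using rect_Young Young_eqI plactic_sym plactic_trans by meson

text \<open>Inserting \<open>x\<close> into \<open>t\<close> amounts to inserting the word
  \<open>x # R_SW t\<close> into the empty tableau. By invariance this word may be replaced by the
  reading of \<open>rect d\<close>, whose insertion returns \<open>rect d\<close>.\<close>

lemma S_l_eq_rect:
  assumes "t \<in> Young n" "d \<in> dSkew n" "R_SW d \<sim> x # R_SW t"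
  shows "S_l t x = rect d"
proof -
  have "S_l t x = insert_left S_l [x] (insert_left S_l (R_SW t) [])"
    using insert_left_S_l_reading[OF assms(1)] by (simp add: insert_left_def)
  also have "\<dots> = insert_left S_l (x # R_SW t) []"
    by (simp add: insert_left_def)
  also have "\<dots> = insert_left S_l (R_SW (rect d)) []"
    using insert_left_S_l_plactic rect_Young(2)[OF assms(2)] assms(3) plactic_sym plactic_trans by meson
  also have "\<dots> = rect d"
    using insert_left_S_l_reading rect_Young(1)[OF assms(2)] .
  finally show ?thesis .
qed

theorem theorem4p3p1:
  fixes n :: nat
  assumes "n \<ge> 1"
  shows "rect ` dSkew n = Young n \<and>
         right_morphism n (dSkew n) [] I_r_a R_SW (Young n) [] S_r R_SW rect \<and>
         left_morphism n (dSkew n) [] I_l_a R_SW (Young n) [] S_l R_SW rect"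
proof -
  have into: "rect ` dSkew n \<subseteq> Young n" using rect_Young(1) by auto
  have onto: "Young n \<subseteq> rect ` dSkew n"
  proof
    fix t assume t: "t \<in> Young n"
    then have "set (R_SW t) \<subseteq> {1..n}" by (intro set_R_SW) (simp add: Young_def)
    then obtain d where "d \<in> dSkew n" "R_SW d = R_SW t" using dSkew_of_word by blast
    then show "t \<in> rect ` dSkew n" using rect_eqI[of d n t] t by auto
  qed
  have empty: "rect [] = []" by (rule rect_eqI) (simp_all add: Young_def)
  have right: "rect (I_r_a d x) = S_r (rect d) x" if "d \<in> dSkew n" "x \<in> {1..n}" for d x
  proof (rule rect_eqI)
    have "R_SW (S_r (rect d) x) \<sim> R_SW (rect d) @ [x]" using that rect_Young S_r_Young by blast
    also have "\<dots> \<sim> R_SW d @ [x]" using that rect_Young by (intro plactic_append_right) blast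
    finally show "R_SW (S_r (rect d) x) \<sim> R_SW (I_r_a d x)" using that by (simp add: I_r_a_dSkew)
  qed (use that rect_Young S_r_Young I_r_a_dSkew in blast)+
  have left: "rect (I_l_a d x) = S_l (rect d) x" if "d \<in> dSkew n" "x \<in> {1..n}" for d x
    using that S_l_eq_rect[of "rect d" n "I_l_a d x" x] I_l_a_dSkew[OF that] rect_Young[OF that(1)]
    by (simp add: plactic_Cons plactic_sym)
  have words: "set (R_SW d) \<subseteq> {1..n}" "set (R_SW (rect d)) \<subseteq> {1..n}" if "d \<in> dSkew n" for d
    by (rule set_R_SW, use that rect_Young(1)[OF that] in \<open>simp add: dSkew_def Young_def\<close>)+
  \<comment> \<open>Row insertion of a word yields a Young tableau in the class of that word, so
    equivalent words give the same tableau.\<close>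
  have "insert_right S_r [] (R_SW d) = insert_right S_r [] (R_SW (rect d))" if "d \<in> dSkew n" for d
  proof (rule Young_eqI)
    note w = words[OF that, THEN insert_right_S_r_Young]
    show "insert_right S_r [] (R_SW d) \<in> Young n" "insert_right S_r [] (R_SW (rect d)) \<in> Young n"
      using w by simp_all
    have "R_SW (insert_right S_r [] (R_SW d)) \<sim> R_SW d" using w by simp
    also have "\<dots> \<sim> R_SW (rect d)" using rect_Young(2)[OF that] by (rule plactic_sym)
    also have "\<dots> \<sim> R_SW (insert_right S_r [] (R_SW (rect d)))" using w by (simp add: plactic_sym)
    finally show "R_SW (insert_right S_r [] (R_SW d)) \<sim> R_SW (insert_right S_r [] (R_SW (rect d)))" .
  qed
  moreover have "insert_left S_l (R_SW d) [] = insert_left S_l (R_SW (rect d)) []" if "d \<in> dSkew n" for d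
    using insert_left_S_l_plactic[OF rect_Young(2)[OF that]] by simp
  ultimately show ?thesis
    using into onto empty right left
    unfolding right_morphism_def left_morphism_def
    by (auto simp: insert_right_def insert_left_def)
qed

end
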